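(* Let $d\ge 1$, let $q\ge 2$ be an integer and let $r_1,\dots,r_d$ be positive integers. The multiple shifted Lucas zeta function $\zeta_U^d(\mathbf s\mid \mathbf r)$ of depth $d$ can be meromorphically continued to all of $\mathbb{C}^d$, with exact list of poles on the hyperplanes $$s_j+\cdots+s_d=-2(k_j+\cdots+k_d)+(k_j+\cdots+k_d)\frac{\log|Q|}{\log\alpha}+\left(\frac{2n}{q}+\ell_{Q,k_j,\ldots,k_d}\right)\frac{\pi i}{\log\alpha}$$ for $1\le j\le d$, where $n\in\mathbb{Z}$ and $k_j,\dots,k_d$ are non-negative integers.
   Context: Standing assumptions: $P,Q$ are real numbers with $P>0$, $Q\ne 0$, $D:=P^2-4Q$, and $Q<P-1$ if $0<P\le 2$, $Q\le P-1$ if $P>2$. Let $\alpha,\beta$ be the roots of $x^2-Px+Q=0$, with $\alpha=(P+\sqrt D)/2$, $\beta=(P-\sqrt D)/2$, and let $U_n=(\alpha^n-\beta^n)/(\alpha-\beta)$ for $n\ge 0$ (Lucas sequence of the first kind). Complex powers of positive reals are taken with the real logarithm. For an integer $q\ge 2$ and positive integers $r_1,\dots,r_d$, the multiple shifted Lucas zeta function of depth $d$ is $$\zeta_U^d(\mathbf s\mid\mathbf r)=\zeta_U^d(s_1,\dots,s_d\mid r_1,\dots,r_d):=\sum_{n_1,\dots,n_d=0}^\infty \frac{1}{U_{qn_1+r_1}^{s_1}}\,\frac{1}{U_{q(n_1+n_2)+(r_1+r_2)}^{s_2}}\cdots\frac{1}{U_{q(n_1+\cdots+n_d)+(r_1+\cdots+r_d)}^{s_d}},$$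 initially defined for $(s_1,\dots,s_d)\in\mathfrak D_d:=\{(s_1,\dots,s_d)\in\mathbb C^d:\ \sum_{i=j}^d\mathrm{Re}(s_i)>0,\ 1\le j\le d\}$, where it converges absolutely. $\ell_{Q,k_j,\dots,k_d}:=0$ if $Q>0$ and $\ell_{Q,k_j,\dots,k_d}:=k_j+\cdots+k_d$ if $Q<0$.
   Formalization: The formal pole list omits the hyperplanes with j=d whose value s_d=-m has m an integer, 0≤m<k_d: there the binomial coefficient vanishes and the pole cancels (e.g. P=2, Q=-8, d=1, k=2, n=-q gives s=-1, a regular point). None is omitted if |β|≤1. *)

theory Defs
  imports "HOL-Analysis.Analysis"
begin

text \<open>
  Points of \<open>\<complex>\<^sup>d\<close> are vectors indexed by a finite linearly ordered type \<open>'d\<close> with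
  \<open>CARD('d) = d\<close>; its order stands for the order of the index set \<open>1, \<dots>, d\<close>, so \<open>{..i}\<close> and
  \<open>{j..}\<close> are the ranges \<open>1, \<dots>, i\<close> and \<open>j, \<dots>, d\<close>.
\<close>

subsection \<open>Meromorphic functions of several complex variables\<close>

text \<open>The second conjunct makes the (a priori real-linear) Frechet derivative complex-linear.\<close>

definition cvec_holomorphic_on :: "(complex^'d \<Rightarrow> complex) \<Rightarrow> (complex^'d::finite) set \<Rightarrow> bool"
  (infix \<open>cvec'_holomorphic'_on\<close> 50)
  where "f cvec_holomorphic_on W \<longleftrightarrow>
    (\<forall>z\<in>W. \<exists>f'. (f has_derivative f') (at z within W) \<and> (\<forall>c v. f' (c *s v) = c * f' v))"

text \<open>
  A meromorphic function is locally a quotient of holomorphic functions. Its values on the thin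
  set where the denominator vanishes carry no information, hence are left unconstrained.
\<close>

definition cvec_meromorphic_on :: "(complex^'d \<Rightarrow> complex) \<Rightarrow> (complex^'d::finite) set \<Rightarrow> bool"
  (infix \<open>cvec'_meromorphic'_on\<close> 50)
  where "f cvec_meromorphic_on A \<longleftrightarrow>
    (\<forall>z\<in>A. \<exists>W g h. open W \<and> connected W \<and> z \<in> W \<and> W \<subseteq> A \<and>
       g cvec_holomorphic_on W \<and> h cvec_holomorphic_on W \<and> (\<exists>w\<in>W. h w \<noteq> 0) \<and>
       (\<forall>w\<in>W. h w \<noteq> 0 \<longrightarrow> f w = g w / h w))"

text \<open>
  The germ of \<open>f\<close> at \<open>z\<close> is holomorphic: off a thin set, \<open>f\<close> agrees near \<open>z\<close> with a holomorphic
  function. The poles of a meromorphic function are the points where this fails, so in dimension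
  at least 2 they include the points of indeterminacy.
\<close>

definition cvec_regular_at :: "(complex^'d \<Rightarrow> complex) \<Rightarrow> complex^'d::finite \<Rightarrow> bool"
  where "cvec_regular_at f z \<longleftrightarrow>
    (\<exists>W g h. open W \<and> connected W \<and> z \<in> W \<and>
       g cvec_holomorphic_on W \<and> h cvec_holomorphic_on W \<and> (\<exists>w\<in>W. h w \<noteq> 0) \<and>
       (\<forall>w\<in>W. h w \<noteq> 0 \<longrightarrow> f w = g w))"

definition cvec_poles :: "(complex^'d \<Rightarrow> complex) \<Rightarrow> (complex^'d::finite) set"
  where "cvec_poles f = {z. \<not> cvec_regular_at f z}"


subsection \<open>Lucas sequences and the multiple shifted Lucas zeta function\<close>

definition lucas_alpha :: "real \<Rightarrow> real \<Rightarrow> real"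
  where "lucas_alpha P Q = (P + sqrt (P\<^sup>2 - 4 * Q)) / 2"

definition lucas_beta :: "real \<Rightarrow> real \<Rightarrow> real"
  where "lucas_beta P Q = (P - sqrt (P\<^sup>2 - 4 * Q)) / 2"

definition lucas_U :: "real \<Rightarrow> real \<Rightarrow> nat \<Rightarrow> real"
  where "lucas_U P Q n =
    (lucas_alpha P Q ^ n - lucas_beta P Q ^ n) / (lucas_alpha P Q - lucas_beta P Q)"

definition multi_lucas_zeta ::
    "real \<Rightarrow> real \<Rightarrow> nat \<Rightarrow> ('d \<Rightarrow> nat) \<Rightarrow> complex^'d::{finite,linorder} \<Rightarrow> complex"
  where "multi_lucas_zeta P Q q r s =
    (\<Sum>\<^sub>\<infinity>n::'d \<Rightarrow> nat. \<Prod>i\<in>UNIV.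
       1 / complex_of_real (lucas_U P Q (q * (\<Sum>l\<in>{..i}. n l) + (\<Sum>l\<in>{..i}. r l))) powr (s $ i))"

definition multi_lucas_domain :: "(complex^'d::{finite,linorder}) set"
  where "multi_lucas_domain = {s. \<forall>j. 0 < (\<Sum>i\<in>{j..}. Re (s $ i))}"

definition lucas_ell :: "real \<Rightarrow> ('d::{finite,linorder} \<Rightarrow> nat) \<Rightarrow> 'd \<Rightarrow> nat"
  where "lucas_ell Q k j = (if Q > 0 then 0 else \<Sum>i\<in>{j..}. k i)"

definition lucas_pole_value ::
    "real \<Rightarrow> real \<Rightarrow> nat \<Rightarrow> 'd::{finite,linorder} \<Rightarrow> ('d \<Rightarrow> nat) \<Rightarrow> int \<Rightarrow> complex"
  where "lucas_pole_value P Q q j k n =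
    - 2 * of_nat (\<Sum>i\<in>{j..}. k i)
    + of_nat (\<Sum>i\<in>{j..}. k i) * of_real (ln \<bar>Q\<bar> / ln (lucas_alpha P Q))
    + (2 * of_int n / of_nat q + of_nat (lucas_ell Q k j))
        * (of_real pi * \<i> / of_real (ln (lucas_alpha P Q)))"

definition lucas_hyperplane ::
    "real \<Rightarrow> real \<Rightarrow> nat \<Rightarrow> 'd::{finite,linorder} \<Rightarrow> ('d \<Rightarrow> nat) \<Rightarrow> int \<Rightarrow> (complex^'d::{finite,linorder}) set"
  where "lucas_hyperplane P Q q j k n =
    {s. (\<Sum>i\<in>{j..}. s $ i) = lucas_pole_value P Q q j k n}"

text \<open>
  The expansion of \<open>U\<^sub>N powr (- s\<^sub>d)\<close> in powers of \<open>\<beta> / \<alpha>\<close> has the binomial coefficient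
  \<open>(- s\<^sub>d) gchoose k\<^sub>d\<close> in front of its \<open>k\<^sub>d\<close>-th term. For \<open>j = d\<close> this coefficient is constant on
  the hyperplane \<open>s\<^sub>d = c\<close>, and when \<open>- c\<close> is one of \<open>0, \<dots>, k\<^sub>d - 1\<close> it is zero and removes the pole.
  This never happens if \<open>Q > 0\<close>, nor if \<open>\<bar>\<beta>\<bar> \<le> 1\<close> (lemmas \<open>not_lucas_cancelled\<close>, \<open>lucas_beta_abs_le_1\<close>).
  For \<open>\<beta> < -1\<close> it can happen (lemma \<open>lucas_cancelled_example\<close>): with \<open>P = 2\<close>, \<open>Q = -8\<close> one has
  \<open>\<alpha> = 4\<close>, \<open>\<beta> = -2\<close>, and \<open>k\<^sub>d = 2\<close>, \<open>n = - q\<close> give the hyperplane \<open>s\<^sub>d = -1\<close>.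
\<close>

definition lucas_cancelled ::
    "real \<Rightarrow> real \<Rightarrow> nat \<Rightarrow> 'd::{finite,linorder} \<Rightarrow> ('d \<Rightarrow> nat) \<Rightarrow> int \<Rightarrow> bool"
  where "lucas_cancelled P Q q j k n \<longleftrightarrow>
    j = Max UNIV \<and> (\<exists>m < k j. lucas_pole_value P Q q j k n = - of_nat m)"

lemma lucas_alpha_gt_1:
  assumes "P > 0" "P \<le> 2 \<longrightarrow> Q < P - 1" "P > 2 \<longrightarrow> Q \<le> P - 1"
  shows "P\<^sup>2 - 4 * Q > 0" "lucas_alpha P Q > 1"
proof -
  have *: "P\<^sup>2 - 4 * Q = (P - 2)\<^sup>2 + 4 * (P - 1 - Q)"
    by (simp add: power2_eq_square algebra_simps)
  show D: "P\<^sup>2 - 4 * Q > 0"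
    proof (cases "P \<le> 2")
    case True
    then have "4 * (P - 1 - Q) > 0" using assms by simp
    then show ?thesis unfolding * by (intro add_nonneg_pos) simp_all
  next
    case False
    then have "(P - 2)\<^sup>2 > 0" "4 * (P - 1 - Q) \<ge> 0" using assms by simp_all
    then show ?thesis unfolding * by (intro add_pos_nonneg)
  qed
  show "lucas_alpha P Q > 1"
  proof (cases "P \<le> 2")
    case True
    then have "(2 - P)\<^sup>2 < P\<^sup>2 - 4 * Q"
      using assms by (simp add: * power2_commute)
    then have "2 - P < sqrt (P\<^sup>2 - 4 * Q)"
      by (rule real_less_rsqrt)
    then show ?thesis by (simp add: lucas_alpha_def)
  next
    case False
    then have "2 < P" by simp
    moreover have "0 < sqrt (P\<^sup>2 - 4 * Q)" using D by (rule real_sqrt_gt_zero)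
    ultimately have "2 + 0 < P + sqrt (P\<^sup>2 - 4 * Q)" by (rule add_strict_mono)
    then show ?thesis by (simp add: lucas_alpha_def)
  qed
qed

lemma lucas_alpha_times_beta:
  assumes "P\<^sup>2 - 4 * Q > 0"
  shows "lucas_alpha P Q * lucas_beta P Q = Q"
proof -
  have "(sqrt (P\<^sup>2 - 4 * Q))\<^sup>2 = P\<^sup>2 - 4 * Q"
    using assms by simp
  then show ?thesis
    by (simp add: lucas_alpha_def lucas_beta_def power2_eq_square algebra_simps)
qed

lemma atLeast_Max_UNIV: "{Max UNIV..} = {Max UNIV :: 'd::{finite,linorder}}"
proof (intro equalityI subsetI)
  fix i :: 'd assume "i \<in> {Max UNIV..}"
  then have "Max UNIV \<le> i" by (rule atLeast_iff[THEN iffD1])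
  moreover have "i \<le> Max UNIV" by (rule Max_ge) simp_all
  ultimately have "i = Max UNIV" by (intro order.antisym)
  then show "i \<in> {Max UNIV}" by (rule ssubst) (rule singletonI)
qed simp

lemma not_lucas_cancelled:
  fixes j :: "'d::{finite,linorder}"
  assumes "P > 0" "Q \<noteq> 0" "P \<le> 2 \<longrightarrow> Q < P - 1" "P > 2 \<longrightarrow> Q \<le> P - 1"
    and b: "\<bar>lucas_beta P Q\<bar> \<le> 1"
  shows "\<not> lucas_cancelled P Q q j k n"
proof
  assume "lucas_cancelled P Q q j k n"
  then obtain m where j: "j = Max UNIV" and m: "m < k j"
    and eq: "lucas_pole_value P Q q j k n = - of_nat m"
    by (auto simp: lucas_cancelled_def)
  have "{j..} = {j}"
    unfolding j by (rule atLeast_Max_UNIV)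
  then have K: "(\<Sum>i\<in>{j..}. k i) = k j" by simp
  define L where "L = ln (lucas_alpha P Q)"
  note a = lucas_alpha_gt_1[OF assms(1,3,4)]
  have L: "L > 0" using a by (simp add: L_def)
  have Q: "lucas_alpha P Q * lucas_beta P Q = Q"
    using a by (intro lucas_alpha_times_beta)
  then have b0: "lucas_beta P Q \<noteq> 0" using assms by auto
  have lnQ: "ln \<bar>Q\<bar> = L + ln \<bar>lucas_beta P Q\<bar>"
    using a b0 by (subst Q[symmetric]) (simp add: L_def abs_mult ln_mult)
  have lnb: "ln \<bar>lucas_beta P Q\<bar> \<le> 0" using b b0 by simp
  have "of_real pi * \<i> / complex_of_real L = of_real (pi / L) * \<i>" by simp
  then have "lucas_pole_value P Q q j k n =
      of_real (- 2 * real (k j) + real (k j) * (ln \<bar>Q\<bar> / L))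
      + of_real ((2 * real_of_int n / real q + real (lucas_ell Q k j)) * (pi / L)) * \<i>"
    unfolding lucas_pole_value_def K L_def by (simp only:) simp
  then have "Re (lucas_pole_value P Q q j k n) = - 2 * real (k j) + real (k j) * (ln \<bar>Q\<bar> / L)"
    by (simp only: plus_complex.sel times_complex.sel Re_complex_of_real Im_complex_of_real imaginary_unit.sel)
  then have "- 2 * real (k j) + real (k j) * (ln \<bar>Q\<bar> / L) = - real m"
    by (simp add: eq)
  moreover have "ln \<bar>Q\<bar> / L \<le> 1"
    using L lnb by (simp add: lnQ divide_simps)
  then have "real (k j) * (ln \<bar>Q\<bar> / L) \<le> real (k j) * 1"
    by (intro mult_left_mono) auto
  ultimately show False using m by simp
qed

lemma lucas_beta_abs_le_1:
  assumes "P > 0" "Q > 0" "P \<le> 2 \<longrightarrow> Q < P - 1" "P > 2 \<longrightarrow> Q \<le> P - 1"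
  shows "\<bar>lucas_beta P Q\<bar> \<le> 1"
proof -
  note a = lucas_alpha_gt_1[OF assms(1,3,4)]
  have Q: "lucas_alpha P Q * lucas_beta P Q = Q"
    using a by (intro lucas_alpha_times_beta)
  have sum: "lucas_alpha P Q + lucas_beta P Q = P"
    by (simp add: lucas_alpha_def lucas_beta_def field_simps)
  have pos: "lucas_beta P Q > 0"
    using Q a assms(2) by (smt (verit) mult_nonneg_nonpos)
  have "Q \<le> P - 1" using assms by (cases "P \<le> 2") auto
  then have "(lucas_alpha P Q - 1) * (lucas_beta P Q - 1) \<le> 0"
    using Q sum by (simp add: algebra_simps)
  then have "lucas_beta P Q \<le> 1"
    using a by (smt (verit) mult_pos_pos)
  then show ?thesis using pos by simp
qed

lemma lucas_cancelled_example:
  fixes k :: "'d::{finite,linorder} \<Rightarrow> nat"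
  assumes "k (Max UNIV) = 2" "q > 0"
  shows "lucas_cancelled 2 (-8) q (Max UNIV) k (- int q)"
proof -
  have "{Max (UNIV :: 'd set)..} = {Max UNIV}"
    by (rule atLeast_Max_UNIV)
  then have K: "(\<Sum>i\<in>{Max UNIV..}. k i) = 2" using assms by simp
  have "sqrt 36 = (6::real)" by (rule real_sqrt_unique) simp_all
  then have a: "lucas_alpha 2 (-8) = 4" by (simp add: lucas_alpha_def)
  have "ln (8::real) = 3 * ln 2" "ln (4::real) = 2 * ln 2"
    using ln_realpow[of "2::real" 3] ln_realpow[of "2::real" 2] by simp_all
  then have l: "ln \<bar>-8\<bar> / ln 4 = (3 / 2 :: real)" by simp
  have "lucas_pole_value 2 (-8) q (Max UNIV) k (- int q) = - of_nat 1"
    unfolding lucas_pole_value_def lucas_ell_def K a l using assms by simp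
  then show ?thesis
    unfolding lucas_cancelled_def using assms by (intro conjI exI[of _ 1]) simp_all
qed

end

theory Submission
  imports Defs "HOL-Complex_Analysis.Conformal_Mappings"
begin

text \<open>
  Put \<open>\<rho> = \<beta> / \<alpha>\<close> and \<open>K\<^sub>i = k\<^sub>i + \<dots> + k\<^sub>d\<close>, \<open>S\<^sub>i = s\<^sub>i + \<dots> + s\<^sub>d\<close>. Expanding each
  \<open>(1 - \<rho>\<^sup>N) powr (- s\<^sub>i)\<close> by the binomial theorem and summing the geometric series in \<open>n\<^sub>i\<close> writes
  the zeta function as a series over multi-indices \<open>k\<close> with the factors
  \<open>X\<^sub>i ^ r\<^sub>i / (1 - X\<^sub>i ^ q)\<close>, where \<open>X\<^sub>i = \<rho> ^ K\<^sub>i * \<alpha> powr (- S\<^sub>i)\<close>. Multiplying by the entire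
  product \<open>\<Prod>i. \<Prod>m. (1 - \<rho> ^ (q * m) * \<alpha> powr (- q * S\<^sub>i))\<close> clears all denominators at once, so the
  continuation is a quotient of two entire functions.

  If the \<open>S\<^sub>i\<close> are pole values for exponents \<open>K\<^sub>i\<close>, only the term of the numerator with these
  \<open>K\<^sub>i\<close> survives, which yields a point of every uncancelled hyperplane where the numerator is nonzero.
  If the function were regular at some other point of the hyperplane, the numerator would vanish on the
  hyperplane near that point, hence along the complex line joining the two points. On a cancelled
  hyperplane \<open>s\<^sub>d = const\<close> every term of the numerator is divisible by the linear form.
\<close>

subsection \<open>Holomorphic functions of several variables\<close>

lemma norm_vector_scalar_mult: "norm (t *s v) = cmod t * norm (v :: complex^'d::finite)"
  by (simp add: norm_vec_def norm_mult L2_set_right_distrib)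

lemma bounded_linear_vector_scalar_mult: "bounded_linear (\<lambda>t. t *s (v :: complex^'d::finite))"
  by (rule bounded_linear_intro[where K = "norm v"])
     (auto simp: vec_eq_iff algebra_simps norm_vector_scalar_mult)

section \<open>Closure properties of holomorphic functions\<close>

lemma cvec_holomorphic_onI:
  assumes "\<And>z. z \<in> W \<Longrightarrow> (f has_derivative f' z) (at z)"
    and "\<And>z c v. z \<in> W \<Longrightarrow> f' z (c *s v) = c * f' z v"
  shows "f cvec_holomorphic_on W"
  unfolding cvec_holomorphic_on_def using assms has_derivative_at_withinI by blast

lemma cvec_holomorphic_onD:
  assumes "f cvec_holomorphic_on W" "open W" "z \<in> W"
  obtains f' where "(f has_derivative f') (at z)" "\<And>c v. f' (c *s v) = c * f' v"
  using assms unfolding cvec_holomorphic_on_def by (metis at_within_open)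

lemma cvec_holomorphic_on_subset:
  assumes "f cvec_holomorphic_on W" "V \<subseteq> W"
  shows "f cvec_holomorphic_on V"
  using assms unfolding cvec_holomorphic_on_def by (meson has_derivative_subset subsetD)

lemma cvec_holomorphic_imp_continuous_on:
  assumes "f cvec_holomorphic_on W"
  shows "continuous_on W f"
  using assms unfolding cvec_holomorphic_on_def continuous_on_eq_continuous_within
  by (meson has_derivative_continuous)

lemma cvec_holomorphic_on_const: "(\<lambda>_. c) cvec_holomorphic_on W"
  by (rule cvec_holomorphic_onI[where f' = "\<lambda>_ _. 0"]) auto

lemma cvec_holomorphic_on_nth: "(\<lambda>z. z $ i) cvec_holomorphic_on W"
  by (rule cvec_holomorphic_onI[where f' = "\<lambda>_ v. v $ i"])
     (auto intro!: bounded_linear_imp_has_derivative bounded_linear_vec_nth)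

lemma cvec_holomorphic_on_add:
  assumes "f cvec_holomorphic_on W" "g cvec_holomorphic_on W"
  shows "(\<lambda>z. f z + g z) cvec_holomorphic_on W"
  unfolding cvec_holomorphic_on_def
proof
  fix z assume "z \<in> W"
  with assms obtain f' g' where
    "(f has_derivative f') (at z within W)" "\<And>c v. f' (c *s v) = c * f' v"
    "(g has_derivative g') (at z within W)" "\<And>c v. g' (c *s v) = c * g' v"
    unfolding cvec_holomorphic_on_def by metis
  then show "\<exists>f'. ((\<lambda>z. f z + g z) has_derivative f') (at z within W) \<and>
      (\<forall>c v. f' (c *s v) = c * f' v)"
    by (intro exI[of _ "\<lambda>v. f' v + g' v"]) (auto simp: algebra_simps intro!: has_derivative_add)
qed

lemma cvec_holomorphic_on_mult:
  assumes "f cvec_holomorphic_on W" "g cvec_holomorphic_on W"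
  shows "(\<lambda>z. f z * g z) cvec_holomorphic_on W"
  unfolding cvec_holomorphic_on_def
proof
  fix z assume "z \<in> W"
  with assms obtain f' g' where
    "(f has_derivative f') (at z within W)" "\<And>c v. f' (c *s v) = c * f' v"
    "(g has_derivative g') (at z within W)" "\<And>c v. g' (c *s v) = c * g' v"
    unfolding cvec_holomorphic_on_def by metis
  then show "\<exists>f'. ((\<lambda>z. f z * g z) has_derivative f') (at z within W) \<and>
      (\<forall>c v. f' (c *s v) = c * f' v)"
    by (intro exI[of _ "\<lambda>v. f z * g' v + f' v * g z"])
       (auto simp: algebra_simps intro!: has_derivative_mult)
qed

lemma cvec_holomorphic_on_diff:
  assumes "f cvec_holomorphic_on W" "g cvec_holomorphic_on W"
  shows "(\<lambda>z. f z - g z) cvec_holomorphic_on W"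
  using cvec_holomorphic_on_add[OF assms(1)
      cvec_holomorphic_on_mult[OF cvec_holomorphic_on_const[of "-1"] assms(2)]] by simp

lemma cvec_holomorphic_on_sum:
  assumes "\<And>i. i \<in> I \<Longrightarrow> f i cvec_holomorphic_on W"
  shows "(\<lambda>z. \<Sum>i\<in>I. f i z) cvec_holomorphic_on W"
  using assms
  by (induction I rule: infinite_finite_induct)
     (auto simp: cvec_holomorphic_on_const intro!: cvec_holomorphic_on_add)

lemma cvec_holomorphic_on_prod:
  assumes "\<And>i. i \<in> I \<Longrightarrow> f i cvec_holomorphic_on W"
  shows "(\<lambda>z. \<Prod>i\<in>I. f i z) cvec_holomorphic_on W"
  using assms
  by (induction I rule: infinite_finite_induct)
     (auto simp: cvec_holomorphic_on_const intro!: cvec_holomorphic_on_mult)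

lemma cvec_holomorphic_on_compose:
  assumes \<phi>: "\<phi> holomorphic_on T" "open T" and f: "f cvec_holomorphic_on W" "f ` W \<subseteq> T"
  shows "(\<lambda>z. \<phi> (f z)) cvec_holomorphic_on W"
  unfolding cvec_holomorphic_on_def
proof
  fix z assume z: "z \<in> W"
  with f obtain f' where
    f': "(f has_derivative f') (at z within W)" "\<And>c v. f' (c *s v) = c * f' v"
    unfolding cvec_holomorphic_on_def by metis
  have "f z \<in> T" using z f by auto
  then have "(\<phi> has_derivative (*) (deriv \<phi> (f z))) (at (f z))"
    using \<phi> holomorphic_derivI has_field_derivative_imp_has_derivative by blast
  from has_derivative_compose[OF f'(1) this]
  have "((\<lambda>z. \<phi> (f z)) has_derivative (\<lambda>v. deriv \<phi> (f z) * f' v)) (at z within W)"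
    by simp
  then show "\<exists>f'. ((\<lambda>z. \<phi> (f z)) has_derivative f') (at z within W) \<and>
      (\<forall>c v. f' (c *s v) = c * f' v)"
    using f'(2) by (intro exI[of _ "\<lambda>v. deriv \<phi> (f z) * f' v"]) auto
qed

lemma cvec_holomorphic_on_divide:
  assumes "f cvec_holomorphic_on W" "g cvec_holomorphic_on W" "\<And>z. z \<in> W \<Longrightarrow> g z \<noteq> 0"
  shows "(\<lambda>z. f z / g z) cvec_holomorphic_on W"
proof -
  have "(\<lambda>z. inverse (g z)) cvec_holomorphic_on W"
    by (rule cvec_holomorphic_on_compose[where T = "- {0}"])
       (use assms in \<open>auto intro!: holomorphic_intros\<close>)
  from cvec_holomorphic_on_mult[OF assms(1) this] show ?thesis by (simp add: divide_inverse)
qed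

section \<open>Restriction to complex lines, Cauchy estimates and uniform limits\<close>

lemma has_field_derivative_along_line:
  fixes f :: "complex^'d::finite \<Rightarrow> complex"
  assumes "(f has_derivative f') (at (x + t *s v))" "\<And>c v. f' (c *s v) = c * f' v"
  shows "((\<lambda>t. f (x + t *s v)) has_field_derivative f' v) (at t)"
proof -
  have "((\<lambda>t. x + t *s v) has_derivative (\<lambda>t. t *s v)) (at t)"
    using has_derivative_add[OF has_derivative_const[of x]
        bounded_linear_imp_has_derivative[OF bounded_linear_vector_scalar_mult[of v], of "at t"]]
    by simp
  \<comment> \<open>Complex linearity turns \<open>f' (t *s v)\<close> into \<open>t * f' v\<close>,
    so the derivative along the line is multiplication by a complex number.\<close>
  from has_derivative_compose[OF this assms(1)] show ?thesis
    by (simp add: assms(2) has_field_derivative_def mult_commute_abs)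
qed

lemma holomorphic_along_line:
  assumes "f cvec_holomorphic_on W" "open W" "\<And>t. t \<in> T \<Longrightarrow> x + t *s v \<in> W"
  shows "(\<lambda>t. f (x + t *s v)) holomorphic_on T"
proof -
  have "\<exists>D. ((\<lambda>t. f (x + t *s v)) has_field_derivative D) (at t)" if t: "t \<in> T" for t
    using cvec_holomorphic_onD[OF assms(1,2) assms(3)[OF t]] has_field_derivative_along_line
    by metis
  then show ?thesis
    by (auto simp: holomorphic_on_def field_differentiable_def
        intro: has_field_derivative_at_within)
qed

text \<open>The number \<open>f' v\<close> is the derivative at 0 of \<open>f\<close> restricted to
  the complex line through \<open>x\<close> in direction \<open>v\<close>, so the one-variable
  Cauchy inequality applies.\<close>

lemma cvec_Cauchy_estimate:
  assumes f: "f cvec_holomorphic_on ball x r" and r: "r > 0"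
    and B: "\<And>z. z \<in> ball x r \<Longrightarrow> cmod (f z) \<le> B"
    and f': "(f has_derivative f') (at x)" "\<And>c v. f' (c *s v) = c * f' v"
  shows "cmod (f' v) \<le> 2 * B / r * norm v"
proof (cases "v = 0")
  case True
  then show ?thesis using f'(2)[of 0 0] by simp
next
  case False
  \<comment> \<open>Half of the largest admissible radius, so that the closed disc is mapped into
    the open ball; this is the source of the factor 2.\<close>
  define R where "R = r / (2 * norm v)"
  have R: "R > 0" using False r by (simp add: R_def)
  have in_ball: "x + t *s v \<in> ball x r" if "cmod t \<le> R" for t
  proof -
    have "cmod t * norm v \<le> R * norm v" using that by (intro mult_right_mono) auto
    also have "\<dots> < r" using False r by (simp add: R_def)
    finally show ?thesis by (simp add: dist_norm norm_vector_scalar_mult)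
  qed
  have hol: "(\<lambda>t. f (x + t *s v)) holomorphic_on cball 0 R"
    by (rule holomorphic_along_line[OF f open_ball]) (use in_ball in auto)
  have "cmod ((deriv ^^ 1) (\<lambda>t. f (x + t *s v)) 0) \<le> fact 1 * B / R ^ 1"
    by (rule Cauchy_inequality)
       (use hol R in_ball B in \<open>auto intro: holomorphic_on_subset holomorphic_on_imp_continuous_on\<close>)
  moreover have "deriv (\<lambda>t. f (x + t *s v)) 0 = f' v"
    by (rule DERIV_imp_deriv, rule has_field_derivative_along_line) (use f' in auto)
  ultimately show ?thesis using False r by (simp add: R_def field_simps)
qed

text \<open>By the Cauchy estimate, uniform convergence of the functions makes their derivatives
  uniformly Cauchy as linear maps. The theorem on differentiating sequences then gives the
  derivative of the limit, and complex linearity survives pointwise limits.\<close>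

lemma cvec_holomorphic_uniform_limit:
  fixes f :: "nat \<Rightarrow> complex^'d::finite \<Rightarrow> complex"
  assumes W: "open W" and f: "\<And>n. f n cvec_holomorphic_on W"
    and lim: "\<And>x. x \<in> W \<Longrightarrow> \<exists>d>0. cball x d \<subseteq> W \<and> uniform_limit (cball x d) f g sequentially"
  shows "g cvec_holomorphic_on W"
  unfolding cvec_holomorphic_on_def
proof
  fix x assume x: "x \<in> W"
  obtain d where d: "d > 0" "cball x d \<subseteq> W" and lim_d: "uniform_limit (cball x d) f g sequentially"
    using lim[OF x] by blast
  define f' where "f' = (\<lambda>n z. SOME D. (f n has_derivative D) (at z) \<and> (\<forall>c v. D (c *s v) = c * D v))"
  have f'_some: "(f n has_derivative f' n z) (at z) \<and> (\<forall>c v. f' n z (c *s v) = c * f' n z v)"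
    if "z \<in> W" for n z
    unfolding f'_def
    by (rule someI_ex[where P = "\<lambda>D. (f n has_derivative D) (at z) \<and> (\<forall>c v. D (c *s v) = c * D v)"])
       (meson cvec_holomorphic_onD[OF f W that])
  then have f': "\<And>n z. z \<in> W \<Longrightarrow> (f n has_derivative f' n z) (at z)"
    and f'_mult: "\<And>n z c v. z \<in> W \<Longrightarrow> f' n z (c *s v) = c * f' n z v" by auto
  define S where "S = ball x (d / 2)"
  have near: "ball y (d / 2) \<subseteq> cball x d" if "y \<in> S" for y
  proof
    fix z assume "z \<in> ball y (d / 2)"
    then have "dist x z < d / 2 + d / 2"
      using that dist_triangle[of x z y] by (simp add: S_def)
    then show "z \<in> cball x d" by simp
  qed
  have S_W: "S \<subseteq> W" using d by (auto simp: S_def)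
  have Cauchy: "\<exists>N. \<forall>m\<ge>N. \<forall>n\<ge>N. \<forall>y\<in>S. \<forall>v. cmod (f' m y v - f' n y v) \<le> e * norm v"
    if e: "e > 0" for e
  proof -
    have "uniformly_Cauchy_on (cball x d) f"
      using lim_d uniformly_convergent_Cauchy uniformly_convergent_on_def by blast
    \<comment> \<open>On a ball of radius \<open>d / 2\<close> the Cauchy estimate multiplies this
      bound by \<open>2 / (d / 2)\<close>, which gives \<open>e\<close>.\<close>
    moreover have "0 < e * d / 4" using e d by simp
    ultimately obtain N where N: "\<And>m n z. m \<ge> N \<Longrightarrow> n \<ge> N \<Longrightarrow> z \<in> cball x d \<Longrightarrow>
        dist (f m z) (f n z) < e * d / 4"
      unfolding uniformly_Cauchy_on_def by metis
    have "cmod (f' m y v - f' n y v) \<le> e * norm v" if "m \<ge> N" "n \<ge> N" "y \<in> S" for m n y v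
    proof -
      have "cmod (f' m y v - f' n y v) \<le> 2 * (e * d / 4) / (d / 2) * norm v"
      proof (rule cvec_Cauchy_estimate[where f = "\<lambda>z. f m z - f n z" and x = y
            and f' = "\<lambda>v. f' m y v - f' n y v"])
        show "(\<lambda>z. f m z - f n z) cvec_holomorphic_on ball y (d / 2)"
          using near[OF that(3)] d f
          by (intro cvec_holomorphic_on_diff) (blast intro: cvec_holomorphic_on_subset)+
        show "cmod (f m z - f n z) \<le> e * d / 4" if "z \<in> ball y (d / 2)" for z
          using N[OF \<open>m \<ge> N\<close> \<open>n \<ge> N\<close>, of z] near[OF \<open>y \<in> S\<close>] that by (auto simp: dist_norm)
        show "((\<lambda>z. f m z - f n z) has_derivative (\<lambda>v. f' m y v - f' n y v)) (at y)"
          using f' S_W that(3) by (intro has_derivative_diff) auto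
      qed (use d f'_mult S_W that(3) in \<open>auto simp: algebra_simps\<close>)
      also have "\<dots> = e * norm v" using d by simp
      finally show ?thesis .
    qed
    then show ?thesis by blast
  qed
  define g' where "g' = (\<lambda>y v. lim (\<lambda>n. f' n y v))"
  have conv: "(\<lambda>n. f' n y v) \<longlonglongrightarrow> g' y v" if y: "y \<in> S" for y v
  proof -
    have "Cauchy (\<lambda>n. f' n y v)"
    proof (rule metric_CauchyI)
      fix e :: real assume e: "e > 0"
      have "e / (norm v + 1) > 0" using e by (simp add: add_nonneg_pos)
      from Cauchy[OF this] obtain N where
        "\<forall>m\<ge>N. \<forall>n\<ge>N. \<forall>y\<in>S. \<forall>u. cmod (f' m y u - f' n y u) \<le> e / (norm v + 1) * norm u"
        by blast
      then have "cmod (f' m y v - f' n y v) \<le> e / (norm v + 1) * norm v" if "m \<ge> N" "n \<ge> N" for m n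
        using y that by blast
      moreover have "e / (norm v + 1) * norm v < e"
        using e add_nonneg_pos[OF norm_ge_zero[of v] zero_less_one] by (simp add: field_simps)
      ultimately show "\<exists>M. \<forall>m\<ge>M. \<forall>n\<ge>M. dist (f' m y v) (f' n y v) < e"
        unfolding dist_norm by (meson le_less_trans)
    qed
    then show ?thesis
      unfolding g'_def by (simp add: Cauchy_convergent_iff convergent_LIMSEQ_iff)
  qed
  have unif: "\<forall>\<^sub>F n in sequentially. \<forall>y\<in>S. \<forall>v. norm (f' n y v - g' y v) \<le> e * norm v"
    if e: "e > 0" for e
  proof -
    obtain N where N: "\<forall>m\<ge>N. \<forall>n\<ge>N. \<forall>y\<in>S. \<forall>v. cmod (f' m y v - f' n y v) \<le> e * norm v"
      using Cauchy[OF e] by blast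
    have "norm (f' m y v - g' y v) \<le> e * norm v" if "m \<ge> N" "y \<in> S" for m y v
    proof (rule tendsto_upperbound)
      show "(\<lambda>n. norm (f' m y v - f' n y v)) \<longlonglongrightarrow> norm (f' m y v - g' y v)"
        by (intro tendsto_intros conv that)
      show "\<forall>\<^sub>F n in sequentially. norm (f' m y v - f' n y v) \<le> e * norm v"
        unfolding eventually_sequentially using N that by blast
    qed auto
    then show ?thesis by (auto simp: eventually_sequentially)
  qed
  have xS: "x \<in> S" using d by (simp add: S_def)
  have g_lim: "(\<lambda>n. f n y) \<longlonglongrightarrow> g y" if "y \<in> S" for y
    using tendsto_uniform_limitI[OF lim_d, of y] that d by (auto simp: S_def)
  have "\<exists>g1. \<forall>y\<in>S. (\<lambda>n. f n y) \<longlonglongrightarrow> g1 y \<and> (g1 has_derivative g' y) (at y within S)"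
  proof (rule has_derivative_sequence[where f' = f' and ?x0.0 = x and l = "g x"])
    show "(f n has_derivative f' n y) (at y within S)" if "y \<in> S" for n y
      using f' S_W that by (blast intro: has_derivative_at_withinI)
  qed (use unif xS g_lim in \<open>auto simp: S_def\<close>)
  then obtain g1 where g1: "\<And>y. y \<in> S \<Longrightarrow> (\<lambda>n. f n y) \<longlonglongrightarrow> g1 y"
      "\<And>y. y \<in> S \<Longrightarrow> (g1 has_derivative g' y) (at y within S)" by blast
  have "g1 y = g y" if "y \<in> S" for y using LIMSEQ_unique g1(1) g_lim that by blast
  then have "(g has_derivative g' x) (at x within S)"
    using g1(2)[OF xS] xS by (metis has_derivative_transform)
  then have "(g has_derivative g' x) (at x)"
    using xS by (simp add: S_def at_within_open[OF _ open_ball])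
  then have "(g has_derivative g' x) (at x within W)" by (rule has_derivative_at_withinI)
  moreover have "g' x (c *s v) = c * g' x v" for c v
  proof (rule LIMSEQ_unique)
    show "(\<lambda>n. f' n x (c *s v)) \<longlonglongrightarrow> g' x (c *s v)" by (rule conv[OF xS])
    show "(\<lambda>n. f' n x (c *s v)) \<longlonglongrightarrow> c * g' x v"
      using x by (simp add: f'_mult) (intro tendsto_intros conv xS)
  qed
  ultimately show "\<exists>f'. (g has_derivative f') (at x within W) \<and> (\<forall>c v. f' (c *s v) = c * f' v)"
    by blast
qed

section \<open>Identity theorem\<close>

lemma cvec_holomorphic_zero_on_ball:
  fixes f :: "complex^'d::finite \<Rightarrow> complex"
  assumes f: "f cvec_holomorphic_on ball x r"
    and U: "open U" "U \<subseteq> ball x r" "U \<noteq> {}" "\<And>z. z \<in> U \<Longrightarrow> f z = 0"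
    and w: "w \<in> ball x r"
  shows "f w = 0"
proof -
  obtain y where y: "y \<in> U" using U by blast
  define T where "T = {t. y + t *s (w - y) \<in> ball x r}"
  define T' where "T' = {t. y + t *s (w - y) \<in> U}"
  have cont: "continuous_on UNIV (\<lambda>t. y + t *s (w - y))"
    by (intro continuous_intros linear_continuous_on bounded_linear_vector_scalar_mult)
  have openT: "open T" "open T'"
    using open_vimage[OF open_ball cont] open_vimage[OF \<open>open U\<close> cont]
    by (simp_all add: T_def T'_def vimage_def)
  \<comment> \<open>The line joins \<open>y\<close> (at \<open>t = 0\<close>) to \<open>w\<close>
    (at \<open>t = 1\<close>). Convexity of the ball passes to its trace \<open>T\<close> on this
    line, which is therefore connected, as the one-variable identity theorem requires.\<close>
  have "convex T"
  proof (rule convexI)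
    fix s t u v assume *: "s \<in> T" "t \<in> T" and uv: "0 \<le> (u::real)" "0 \<le> v" "u + v = 1"
    have "u *\<^sub>R (y + s *s (w - y)) + v *\<^sub>R (y + t *s (w - y)) \<in> ball x r"
      using * uv by (intro convexD[OF convex_ball]) (auto simp: T_def)
    moreover have "u *\<^sub>R (y + s *s (w - y)) + v *\<^sub>R (y + t *s (w - y)) =
        (u + v) *\<^sub>R y + (u *\<^sub>R s + v *\<^sub>R t) *s (w - y)"
      by (subst vec_eq_iff, simp, simp add: scaleR_conv_of_real algebra_simps)
    ultimately show "u *\<^sub>R s + v *\<^sub>R t \<in> T" using uv by (simp add: T_def)
  qed
  then have conn: "connected T" by (rule convex_connected)
  have hol: "(\<lambda>t. f (y + t *s (w - y))) holomorphic_on T"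
    by (rule holomorphic_along_line[OF f open_ball]) (simp add: T_def)
  have sub: "T' \<subseteq> T" using U by (auto simp: T_def T'_def)
  have "T' \<noteq> {}" using y by (auto simp: T'_def intro: exI[of _ 0])
  moreover have "f (y + t *s (w - y)) = 0" if "t \<in> T'" for t
    using that U(4) by (simp add: T'_def)
  moreover have "1 \<in> T" using w by (simp add: T_def)
  ultimately have "f (y + 1 *s (w - y)) = 0"
    using analytic_continuation_open[OF openT(2,1) _ conn sub hol holomorphic_on_const] by blast
  then show ?thesis by simp
qed

text \<open>The interior \<open>Z\<close> of the zero set is also closed in \<open>W\<close>: a
  small ball around a limit point of \<open>Z\<close> meets \<open>Z\<close>, so \<open>f\<close>
  vanishes on the whole ball. Connectedness of \<open>W\<close> finishes the argument.\<close>

lemma cvec_holomorphic_identity: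
  fixes f :: "complex^'d::finite \<Rightarrow> complex"
  assumes f: "f cvec_holomorphic_on W" and W: "open W" "connected W"
    and U: "open U" "U \<subseteq> W" "U \<noteq> {}" "\<And>z. z \<in> U \<Longrightarrow> f z = 0"
    and w: "w \<in> W"
  shows "f w = 0"
proof -
  define Z where "Z = interior {z \<in> W. f z = 0}"
  have ZW: "Z \<subseteq> W" and Z0: "\<And>z. z \<in> Z \<Longrightarrow> f z = 0"
    using interior_subset by (fastforce simp: Z_def)+
  have "open (W - Z)"
  proof (rule openI)
    fix x assume x: "x \<in> W - Z"
    then obtain e where e: "e > 0" "ball x e \<subseteq> W" using W open_contains_ball by blast
    have "ball x e \<inter> Z = {}"
    proof (rule ccontr)
      assume "ball x e \<inter> Z \<noteq> {}"
      moreover have "open (ball x e \<inter> Z)" by (intro open_Int) (simp_all add: Z_def)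
      ultimately have "f z = 0" if "z \<in> ball x e" for z
        using cvec_holomorphic_zero_on_ball[OF cvec_holomorphic_on_subset[OF f e(2)], of "ball x e \<inter> Z" z]
          Z0 that by blast
      then have "x \<in> Z"
        unfolding Z_def using e by (intro interiorI[of "ball x e"]) auto
      then show False using x by blast
    qed
    then show "\<exists>e>0. ball x e \<subseteq> W - Z" using e by blast
  qed
  moreover have "open Z" by (simp add: Z_def)
  moreover have "U \<subseteq> Z" unfolding Z_def using U by (intro interior_maximal) auto
  ultimately have "W - Z = {}"
    using connectedD[OF W(2), of Z "W - Z"] ZW U(3) by blast
  then show ?thesis using w Z0 by blast
qed

text \<open>The function \<open>f\<close> vanishes on the nonempty open set where \<open>g\<close>
  does not. This is how the thin exceptional sets in the definition of regularity are removed
  later.\<close>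

lemma cvec_holomorphic_zero_if_mult_zero:
  fixes f g :: "complex^'d::finite \<Rightarrow> complex"
  assumes f: "f cvec_holomorphic_on W" and g: "g cvec_holomorphic_on W"
    and W: "open W" "connected W"
    and fg: "\<And>z. z \<in> W \<Longrightarrow> f z * g z = 0" and nz: "\<exists>z\<in>W. g z \<noteq> 0"
    and w: "w \<in> W"
  shows "f w = 0"
proof -
  define U where "U = W \<inter> g -` (- {0})"
  have "open U"
    unfolding U_def using cvec_holomorphic_imp_continuous_on[OF g] W
    by (intro continuous_open_preimage) auto
  moreover have "U \<subseteq> W" "U \<noteq> {}" "\<And>z. z \<in> U \<Longrightarrow> f z = 0"
    using fg nz by (auto simp: U_def)
  ultimately show ?thesis
    using cvec_holomorphic_identity[OF f W] w by blast
qed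

subsection \<open>Infinite products of factors $1 - w^m y$\<close>

text \<open>The infinite q-Pochhammer symbol of base \<open>w\<close>, with the factors whose index
  lies in \<open>A\<close> left out. The case \<open>A = {}\<close> gives the common denominator,
  and \<open>A = {K}\<close> what remains of it after one cancellation.\<close>

definition qprod :: "complex \<Rightarrow> nat set \<Rightarrow> complex \<Rightarrow> complex"
  where "qprod w A y = (\<Prod>m. if m \<in> A then 1 else 1 - w ^ m * y)"

lemma summable_qprod:
  fixes w y :: complex
  assumes "norm w < 1"
  shows "summable (\<lambda>m. norm ((if m \<in> A then 1 else 1 - w ^ m * y) - 1))"
proof (rule summable_comparison_test')
  show "summable (\<lambda>m. norm w ^ m * norm y)"
    using assms by (intro summable_mult2 summable_geometric) simp
  show "norm (norm ((if m \<in> A then 1 else 1 - w ^ m * y) - 1)) \<le> norm w ^ m * norm y" if "m \<ge> 0" for m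
    by (simp add: norm_mult norm_power)
qed

lemma convergent_qprod:
  fixes w y :: complex
  assumes "norm w < 1"
  shows "convergent_prod (\<lambda>m. if m \<in> A then 1 else 1 - w ^ m * y)"
  by (intro abs_convergent_prod_imp_convergent_prod summable_imp_abs_convergent_prod
      summable_qprod assms)

lemma qprod_LIMSEQ:
  assumes "norm w < 1"
  shows "(\<lambda>n. \<Prod>m<n. if m \<in> A then 1 else 1 - w ^ m * y) \<longlonglongrightarrow> qprod w A y"
proof -
  have "(\<lambda>n. \<Prod>m<Suc n. if m \<in> A then 1 else 1 - w ^ m * y) \<longlonglongrightarrow> qprod w A y"
    using convergent_prod_LIMSEQ[OF convergent_qprod[OF assms]]
    by (simp add: qprod_def lessThan_Suc_atMost)
  then show ?thesis by (subst (asm) filterlim_sequentially_Suc)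
qed

lemma qprod_holomorphic:
  assumes w: "norm w < 1"
  shows "qprod w A holomorphic_on UNIV"
proof (rule holomorphic_uniform_sequence)
  fix x :: complex
  let ?f = "\<lambda>m y. (if m \<in> A then 1 else 1 - w ^ m * y)"
  define B where "B = norm x + 1"
  have B: "norm y \<le> B" if "y \<in> cball x 1" for y
    using that norm_triangle_ineq2[of y x] by (auto simp: B_def dist_norm norm_minus_commute)
  have "uniformly_convergent_on (cball x 1) (\<lambda>n y. \<Prod>m<n. ?f m y)"
  proof (rule uniformly_convergent_on_prod')
    show "uniformly_convergent_on (cball x 1) (\<lambda>n y. \<Sum>m<n. norm (?f m y - 1))"
    proof (rule Weierstrass_m_test')
      show "summable (\<lambda>m. norm w ^ m * B)"
        using w by (intro summable_mult2 summable_geometric) simp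
      fix m y assume "y \<in> cball x 1"
      then show "norm (norm (?f m y - 1)) \<le> norm w ^ m * B"
        using B[of y] by (auto simp: norm_mult norm_power B_def intro!: mult_left_mono)
    qed
    show "continuous_on (cball x 1) (?f m)" for m
      by (cases "m \<in> A") (auto intro!: continuous_intros)
  qed auto
  then obtain g where g: "uniform_limit (cball x 1) (\<lambda>n y. \<Prod>m<n. ?f m y) g sequentially"
    by (auto simp: uniformly_convergent_on_def)
  have "g y = qprod w A y" if "y \<in> cball x 1" for y
    using tendsto_uniform_limitI[OF g that] qprod_LIMSEQ[OF w] LIMSEQ_unique by blast
  then have "uniform_limit (cball x 1) (\<lambda>n y. \<Prod>m<n. ?f m y) (qprod w A) sequentially"
    using g by (subst uniform_limit_cong'[where g = "\<lambda>n y. \<Prod>m<n. ?f m y" and i = g]) auto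
  then show "\<exists>d>0. cball x d \<subseteq> UNIV \<and>
      uniform_limit (cball x d) (\<lambda>n y. \<Prod>m<n. ?f m y) (qprod w A) sequentially"
    by (intro exI[of _ 1]) auto
next
  have "(\<lambda>y. if m \<in> A then 1 else 1 - w ^ m * y) holomorphic_on UNIV" for m
    by (cases "m \<in> A") (auto intro!: holomorphic_intros)
  then show "(\<lambda>y. \<Prod>m<n. if m \<in> A then 1 else 1 - w ^ m * y) holomorphic_on UNIV" for n
    by (intro holomorphic_on_prod)
qed auto

text \<open>Each factor is at most \<open>exp (norm w ^ m * norm y)\<close>, and the exponents form
  a geometric series. The bound does not involve \<open>A\<close>, which makes later estimates
  uniform in the omitted index.\<close>

lemma norm_qprod_le:
  assumes w: "norm w < 1"
  shows "norm (qprod w A y) \<le> exp (norm y / (1 - norm w))"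
proof (rule tendsto_upperbound)
  show "(\<lambda>n. norm (\<Prod>m<n. if m \<in> A then 1 else 1 - w ^ m * y)) \<longlonglongrightarrow> norm (qprod w A y)"
    by (intro tendsto_norm qprod_LIMSEQ w)
  have "norm (\<Prod>m<n. if m \<in> A then 1 else 1 - w ^ m * y) \<le> exp (norm y / (1 - norm w))" for n
  proof -
    have "norm (\<Prod>m<n. if m \<in> A then 1 else 1 - w ^ m * y) \<le> (\<Prod>m<n. exp (norm w ^ m * norm y))"
      unfolding prod_norm[symmetric]
    proof (rule prod_mono, safe)
      fix m
      have "norm (1 - w ^ m * y) \<le> 1 + norm w ^ m * norm y"
        by (rule order.trans[OF norm_triangle_ineq4]) (simp add: norm_mult norm_power)
      also have "\<dots> \<le> exp (norm w ^ m * norm y)" by (rule exp_ge_add_one_self)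
      finally show "norm (if m \<in> A then 1 else 1 - w ^ m * y) \<le> exp (norm w ^ m * norm y)"
        by simp
    qed simp
    also have "\<dots> = exp ((\<Sum>m<n. norm w ^ m) * norm y)"
      by (simp add: exp_sum sum_distrib_right)
    also have "\<dots> \<le> exp (1 / (1 - norm w) * norm y)"
    proof (subst exp_le_cancel_iff, rule mult_right_mono)
      show "(\<Sum>m<n. norm w ^ m) \<le> 1 / (1 - norm w)"
        using sum_le_suminf[OF summable_geometric, of "norm w" "{..<n}"] suminf_geometric[of "norm w"] w
        by simp
    qed simp
    finally show ?thesis by simp
  qed
  then show "\<forall>\<^sub>F n in sequentially. norm (\<Prod>m<n. if m \<in> A then 1 else 1 - w ^ m * y)
      \<le> exp (norm y / (1 - norm w))" by simp
qed simp

text \<open>The split-off factor is itself an infinite product with one nontrivial entry, so the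
  claim is multiplicativity of convergent products.\<close>

lemma qprod_insert:
  assumes w: "norm w < 1" and k: "k \<notin> A"
  shows "qprod w A y = (1 - w ^ k * y) * qprod w (insert k A) y"
proof -
  have single: "(\<lambda>m. if m = k then 1 - w ^ m * y else 1) has_prod (1 - w ^ k * y)"
    by (rule has_prod_single)
  have "(1 - w ^ k * y) * qprod w (insert k A) y =
      (\<Prod>m. (if m = k then 1 - w ^ m * y else 1) * (if m \<in> insert k A then 1 else 1 - w ^ m * y))"
    unfolding qprod_def has_prod_unique[OF single]
    by (rule prodinf_mult[OF _ convergent_qprod[OF w]]) (use single in \<open>simp add: has_prod_iff\<close>)
  also have "\<dots> = qprod w A y"
    unfolding qprod_def by (rule prodinf_cong) (use k in auto)
  finally show ?thesis by simp
qed

text \<open>A convergent infinite product without zero factors is nonzero; conversely a zero factor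
  can be split off.\<close>

lemma qprod_eq_0_iff:
  assumes w: "norm w < 1"
  shows "qprod w A y = 0 \<longleftrightarrow> (\<exists>m. m \<notin> A \<and> w ^ m * y = 1)"
proof
  assume "qprod w A y = 0"
  then have "\<exists>m. (if m \<in> A then 1 else 1 - w ^ m * y) = 0"
    using prodinf_nonzero[OF convergent_qprod[OF w]] unfolding qprod_def by blast
  then show "\<exists>m. m \<notin> A \<and> w ^ m * y = 1" by (auto split: if_splits)
next
  assume "\<exists>m. m \<notin> A \<and> w ^ m * y = 1"
  then show "qprod w A y = 0" using qprod_insert[OF w] by auto
qed

subsection \<open>Estimates for generalized binomial coefficients\<close>

text \<open>In the product formula each factor satisfies
  \<open>norm (- z - of_nat i) \<le> R + of_nat i\<close>, with equality at the real point
  \<open>R\<close>. Hence one binomial series majorizes the whole disc.\<close>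

lemma norm_gbinomial_le:
  fixes z :: complex
  assumes "norm z \<le> R"
  shows "norm ((- z) gchoose k) \<le> norm ((- complex_of_real R) gchoose k)"
proof -
  have R: "R \<ge> 0" using assms norm_ge_zero order_trans by blast
  have "(\<Prod>i=0..<k. norm (- z - of_nat i)) \<le> (\<Prod>i=0..<k. norm (- complex_of_real R - of_nat i))"
  proof (rule prod_mono, safe)
    fix i
    have "norm (- z - of_nat i) \<le> R + of_nat i"
      by (rule order.trans[OF norm_triangle_ineq4]) (use assms in simp)
    also have "\<dots> = norm (- complex_of_real (R + of_nat i))"
      using R by (subst norm_minus_cancel, subst norm_of_real) simp
    finally show "norm (- z - of_nat i) \<le> norm (- complex_of_real R - of_nat i)" by simp
  qed simp
  then show ?thesis
    by (simp add: gbinomial_prod_rev norm_divide prod_norm divide_right_mono)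
qed

lemma summable_norm_gbinomial:
  assumes "0 \<le> x" "x < 1"
  shows "summable (\<lambda>k. norm (z gchoose k :: complex) * x ^ k)"
proof -
  have "summable (\<lambda>k. norm ((z gchoose k) * complex_of_real x ^ k))"
    by (rule abs_summable_in_conv_radius) (use assms in \<open>auto simp: conv_radius_gchoose\<close>)
  then show ?thesis using assms by (simp add: norm_mult norm_power)
qed

subsection \<open>Series over multi-indices\<close>

lemma abs_summable_prod_UNIV:
  fixes f :: "'d::finite \<Rightarrow> nat \<Rightarrow> 'a::{real_normed_field,banach,second_countable_topology}"
  assumes "\<And>i. summable (\<lambda>k. norm (f i k))"
  shows "(\<lambda>k. norm (\<Prod>i\<in>UNIV. f i (k i))) summable_on UNIV"
proof -
  have "Infinite_Set_Sum.abs_summable_on (\<lambda>k. \<Prod>i\<in>UNIV. f i (k i)) (PiE UNIV (\<lambda>_. UNIV))"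
    by (intro Infinite_Set_Sum.abs_summable_on_prod_PiE)
       (use assms in \<open>auto simp: abs_summable_equivalent[symmetric] summable_on_UNIV_nonneg_real_iff\<close>)
  then show ?thesis by (simp add: abs_summable_equivalent[symmetric])
qed

lemma infsum_prod_UNIV:
  fixes f :: "'d::finite \<Rightarrow> nat \<Rightarrow> 'a::{real_normed_field,banach}"
  assumes "\<And>i. summable (\<lambda>k. norm (f i k))"
  shows "(\<Sum>\<^sub>\<infinity>k. \<Prod>i\<in>UNIV. f i (k i)) = (\<Prod>i\<in>UNIV. \<Sum>k. f i k)"
proof -
  have "infsum (\<lambda>k. \<Prod>i\<in>UNIV. f i (k i)) (PiE UNIV (\<lambda>_. UNIV)) = (\<Prod>i\<in>UNIV. infsum (f i) UNIV)"
    by (intro infsum_prod_PiE_abs) (use assms in \<open>auto simp: summable_on_UNIV_nonneg_real_iff\<close>)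
  moreover have "infsum (f i) UNIV = suminf (f i)" for i
    using norm_summable_imp_has_sum[OF assms] summable_norm_cancel[OF assms]
    by (auto intro: infsumI simp: summable_sums)
  ultimately show ?thesis by simp
qed

abbreviation tail_sum :: "('d::{finite,linorder} \<Rightarrow> 'a::comm_monoid_add) \<Rightarrow> 'd \<Rightarrow> 'a"
  where "tail_sum f j \<equiv> \<Sum>i\<in>{j..}. f i"

text \<open>The majorant depends on \<open>k i\<close> alone although \<open>\<psi>\<close> sees the
  tail sum, because the bound is required for every \<open>K \<ge> k\<close> and tail sums dominate
  their first entry. The series is thus dominated by a product of one-variable series. Arbitrary
  \<open>a\<close> and \<open>\<psi>\<close> allow a second use, after a linear factor has been
  divided out.\<close>

lemma multi_series:
  fixes a \<psi> :: "'d::{finite,linorder} \<Rightarrow> nat \<Rightarrow> complex \<Rightarrow> complex"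
  assumes a: "\<And>i k. a i k holomorphic_on UNIV" and \<psi>: "\<And>i k. \<psi> i k holomorphic_on UNIV"
    and bound: "\<And>i R. \<exists>M. summable M \<and>
      (\<forall>k K z w. k \<le> K \<longrightarrow> norm z \<le> R \<longrightarrow> norm w \<le> R \<longrightarrow> norm (a i k z * \<psi> i K w) \<le> M k)"
  defines "T \<equiv> (\<lambda>k s. \<Prod>i\<in>UNIV. a i (k i) (s $ i) * \<psi> i (tail_sum k i) (tail_sum (($) s) i))"
  shows "(\<lambda>s. \<Sum>\<^sub>\<infinity>k. T k s) cvec_holomorphic_on UNIV"
    and "(\<lambda>k. norm (T k s)) summable_on UNIV"
proof -
  have *: "\<exists>M. M summable_on UNIV \<and> (\<forall>k. \<forall>s\<in>cball x 1. norm (T k s) \<le> M k)" for x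
  proof -
    \<comment> \<open>This bounds both the coordinates and all tail sums on the unit ball around
      \<open>x\<close>.\<close>
    define R where "R = real CARD('d) * (norm x + 1)"
    have R: "R \<ge> 0" by (simp add: R_def)
    have "norm s \<le> norm x + 1" if "s \<in> cball x 1" for s
      using that norm_triangle_ineq2[of s x] by (auto simp: dist_norm norm_minus_commute)
    then have nth: "norm (s $ i) \<le> norm x + 1" if "s \<in> cball x 1" for s i
      using that Finite_Cartesian_Product.norm_nth_le[of s i] by (meson order_trans)
    have nth_R: "norm (s $ i) \<le> R" if "s \<in> cball x 1" for s i
    proof -
      have "1 * (norm x + 1) \<le> R" unfolding R_def by (intro mult_right_mono) (auto simp: Suc_le_eq)
      then show ?thesis using nth[OF that, of i] by simp
    qed
    have tail_R: "norm (tail_sum (($) s) i) \<le> R" if "s \<in> cball x 1" for s i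
    proof -
      have "norm (tail_sum (($) s) i) \<le> real (card {i..}) * (norm x + 1)"
        by (rule sum_norm_bound) (use nth that in auto)
      also have "\<dots> \<le> R" unfolding R_def by (intro mult_right_mono) (auto intro: card_mono)
      finally show ?thesis .
    qed
    obtain M where M: "\<And>i. summable (M i)"
      "\<And>i k K z w. k \<le> K \<Longrightarrow> norm z \<le> R \<Longrightarrow> norm w \<le> R \<Longrightarrow> norm (a i k z * \<psi> i K w) \<le> M i k"
      using bound[where R = R] by metis
    have M0: "M i k \<ge> 0" for i k
      using order_trans[OF norm_ge_zero M(2)[of k k 0 0 i]] R by simp
    have "norm (T k s) \<le> (\<Prod>i\<in>UNIV. M i (k i))" if "s \<in> cball x 1" for k s
      unfolding T_def prod_norm[symmetric]
      by (intro prod_mono conjI M(2) norm_ge_zero nth_R tail_R that member_le_sum) auto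
    moreover have "(\<lambda>k. \<Prod>i\<in>UNIV. M i (k i)) summable_on UNIV"
      using abs_summable_prod_UNIV[of M] M M0 by (simp add: prod_nonneg)
    ultimately show ?thesis by blast
  qed
  show "(\<lambda>k. norm (T k s)) summable_on UNIV"
  proof -
    obtain M where "M summable_on UNIV" "\<forall>k. \<forall>t\<in>cball s 1. norm (T k t) \<le> M k"
      using *[of s] by blast
    then show ?thesis by (intro Infinite_Sum.abs_summable_on_comparison_test'[of M]) auto
  qed
  \<comment> \<open>Cubes exhaust the multi-indices and are cofinal among the finite sets, so the
    unordered sum becomes the limit of a sequence.\<close>
  define B where "B = (\<lambda>N::nat. {k :: 'd \<Rightarrow> nat. \<forall>i. k i \<le> N})"
  have B_lim: "filterlim B (finite_subsets_at_top UNIV) sequentially"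
    unfolding filterlim_finite_subsets_at_top
  proof (intro allI impI)
    fix X :: "('d \<Rightarrow> nat) set" assume X: "finite X \<and> X \<subseteq> UNIV"
    have fin: "finite (B N)" for N
    proof -
      have "B N = PiE UNIV (\<lambda>_. {..N})" by (auto simp: B_def)
      then show ?thesis by (simp add: finite_PiE)
    qed
    define N0 where "N0 = (\<Sum>k\<in>X. \<Sum>i\<in>UNIV. k i)"
    have "k i \<le> N" if "k \<in> X" "N \<ge> N0" for k i N
    proof -
      have "k i \<le> (\<Sum>i\<in>UNIV. k i)" by (rule member_le_sum) auto
      also have "\<dots> \<le> N0"
        unfolding N0_def using X that by (intro member_le_sum[where f = "\<lambda>k. \<Sum>i\<in>UNIV. k i"]) auto
      finally show ?thesis using that by simp
    qed
    then show "\<forall>\<^sub>F N in sequentially. finite (B N) \<and> X \<subseteq> B N \<and> B N \<subseteq> UNIV"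
      unfolding eventually_sequentially using fin by (intro exI[of _ N0]) (auto simp: B_def)
  qed
  show "(\<lambda>s. \<Sum>\<^sub>\<infinity>k. T k s) cvec_holomorphic_on UNIV"
  proof (rule cvec_holomorphic_uniform_limit[where f = "\<lambda>N s. \<Sum>k\<in>B N. T k s"])
    have "(\<lambda>s. a i k (s $ i)) cvec_holomorphic_on UNIV" for i k
      by (rule cvec_holomorphic_on_compose[OF a open_UNIV cvec_holomorphic_on_nth]) auto
    moreover have "(\<lambda>s. \<psi> i k (tail_sum (($) s) i)) cvec_holomorphic_on UNIV" for i k
      by (rule cvec_holomorphic_on_compose[OF \<psi> open_UNIV
            cvec_holomorphic_on_sum[OF cvec_holomorphic_on_nth]]) auto
    ultimately show "(\<lambda>s. \<Sum>k\<in>B N. T k s) cvec_holomorphic_on UNIV" for N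
      unfolding T_def
      by (intro cvec_holomorphic_on_sum cvec_holomorphic_on_prod cvec_holomorphic_on_mult)
    fix x :: "complex^'d::{finite,linorder}"
    obtain M where "M summable_on UNIV" "\<And>k s. s \<in> cball x 1 \<Longrightarrow> norm (T k s) \<le> M k"
      using *[of x] by blast
    then have "uniform_limit (cball x 1) (\<lambda>X s. \<Sum>k\<in>X. T k s) (\<lambda>s. \<Sum>\<^sub>\<infinity>k. T k s)
        (finite_subsets_at_top UNIV)"
      by (intro Weierstrass_m_test_general) auto
    then have "uniform_limit (cball x 1) (\<lambda>N s. \<Sum>k\<in>B N. T k s) (\<lambda>s. \<Sum>\<^sub>\<infinity>k. T k s) sequentially"
      using B_lim by (rule filterlim_compose)
    then show "\<exists>d>0. cball x d \<subseteq> UNIV \<and>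
        uniform_limit (cball x d) (\<lambda>N s. \<Sum>k\<in>B N. T k s) (\<lambda>s. \<Sum>\<^sub>\<infinity>k. T k s) sequentially"
      by (intro exI[of _ 1]) auto
  qed auto
qed

text \<open>Removable singularity at \<open>c\<close>. The value \<open>u c\<close> is recorded
  because it decides whether the root is simple.\<close>

lemma holomorphic_divide_root:
  assumes f: "f holomorphic_on UNIV" and f0: "f c = 0"
  obtains u where "u holomorphic_on UNIV" "\<And>z. f z = (z - c) * u z" "u c = deriv f c"
proof -
  define u where "u = (\<lambda>z. if z = c then deriv f c else (f z - f c) / (z - c))"
  have "u holomorphic_on UNIV" unfolding u_def by (rule pole_lemma) (use f in auto)
  moreover have "f z = (z - c) * u z" for z by (simp add: u_def f0)
  moreover have "u c = deriv f c" by (simp add: u_def)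
  ultimately show ?thesis using that by blast
qed

text \<open>Maximum modulus on a disc around \<open>c\<close> of radius at least 1: on its boundary
  \<open>norm (z - c) \<ge> 1\<close>, so \<open>u\<close> is bounded there by \<open>f\<close>.
  Majorants thus survive division by \<open>z - c\<close>.\<close>

lemma norm_divide_root_le:
  assumes u: "u holomorphic_on UNIV" and f: "\<And>z. f z = (z - c) * u z"
    and M: "\<And>z. norm z \<le> R + 2 * norm c + 1 \<Longrightarrow> norm (f z) \<le> M" and z: "norm z \<le> R"
  shows "norm (u z) \<le> M"
proof -
  have R: "R \<ge> 0" using z norm_ge_zero order_trans by blast
  show ?thesis
  proof (rule maximum_modulus_frontier[where f = u and \<xi> = z and S = "cball c (R + norm c + 1)"])
    show "z \<in> cball c (R + norm c + 1)"
      using z norm_triangle_ineq4[of c z] by (simp add: dist_norm)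
    fix \<zeta> assume "\<zeta> \<in> frontier (cball c (R + norm c + 1))"
    then have \<zeta>: "norm (\<zeta> - c) = R + norm c + 1"
      using R by (simp add: dist_norm norm_minus_commute add_nonneg_nonneg)
    then have "norm \<zeta> \<le> R + 2 * norm c + 1" using norm_triangle_ineq2[of \<zeta> c] by simp
    from M[OF this] have "norm (\<zeta> - c) * norm (u \<zeta>) \<le> M" by (simp add: f norm_mult)
    moreover have "1 * norm (u \<zeta>) \<le> norm (\<zeta> - c) * norm (u \<zeta>)"
      unfolding \<zeta> by (rule mult_right_mono) (use R in auto)
    ultimately show "norm (u \<zeta>) \<le> M" by simp
  qed (use u in \<open>auto intro: holomorphic_on_subset holomorphic_on_imp_continuous_on\<close>)
qed

lemma gbinomial_eq_0_iff:
  fixes z :: complex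
  shows "(z gchoose k) = 0 \<longleftrightarrow> (\<exists>m<k. z = of_nat m)"
  by (auto simp: gbinomial_prod_rev)

text \<open>Both sides run over the pairs \<open>l \<le> i\<close>. This exchange turns the head
  sums in the indices of the Lucas numbers into tail sums of the variables.\<close>

lemma prod_power_head_sum:
  fixes y :: "'d::{finite,linorder} \<Rightarrow> 'a::comm_semiring_1"
  shows "(\<Prod>i\<in>UNIV. y i ^ (\<Sum>l\<in>{..i}. m l)) = (\<Prod>l\<in>UNIV. (\<Prod>i\<in>{l..}. y i) ^ m l)"
proof -
  have "(\<Prod>i\<in>UNIV. \<Prod>l\<in>{l\<in>UNIV. l \<le> i}. y i ^ m l) = (\<Prod>l\<in>UNIV. \<Prod>i\<in>{i\<in>UNIV. l \<le> i}. y i ^ m l)"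
    by (rule prod.swap_restrict) auto
  then show ?thesis by (simp add: power_sum prod_power_distrib atMost_def atLeast_def)
qed

subsection \<open>The meromorphic continuation and its poles\<close>

text \<open>
  In the application \<open>L = ln \<alpha>\<close>, \<open>\<rho> = \<beta> / \<alpha>\<close> and \<open>c = \<alpha> - \<beta>\<close>, so that \<open>lat z\<close> is \<open>\<alpha> powr (- z)\<close>.
\<close>

locale geometric_zeta =
  fixes L \<rho> c :: real and q :: nat and r :: "'d::{finite,linorder} \<Rightarrow> nat"
  assumes L: "L > 0" and \<rho>: "\<rho> \<noteq> 0" "\<bar>\<rho>\<bar> < 1" and c: "c > 0" and q: "q > 0"
    and r: "\<And>i. r i > 0"
begin

definition w :: complex where "w = complex_of_real \<rho> ^ q"

definition lat :: "complex \<Rightarrow> complex" where "lat z = exp (- (z * of_real L))"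

text \<open>The coefficient of \<open>(\<rho> ^ k * lat z) ^ N\<close> when the \<open>N\<close>-th
  Lucas number to the power \<open>- z\<close> is expanded by the binomial series.\<close>

definition coef :: "nat \<Rightarrow> complex \<Rightarrow> complex"
  where "coef k z = exp (z * of_real (ln c)) * ((- z) gchoose k) * (- 1) ^ k"

text \<open>With \<open>X = \<rho> ^ K * lat z\<close> this is \<open>X ^ r i / (1 - X ^ q)\<close>
  times \<open>den z\<close>: since \<open>X ^ q = w ^ K * lat z ^ q\<close>, the fraction cancels
  exactly the factor of index \<open>K\<close>.\<close>

definition num :: "'d \<Rightarrow> nat \<Rightarrow> complex \<Rightarrow> complex"
  where "num i K z = (of_real \<rho> ^ K * lat z) ^ r i * qprod w {K} (lat z ^ q)"

definition den :: "complex \<Rightarrow> complex" where "den z = qprod w {} (lat z ^ q)"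

definition numer :: "complex^'d::{finite,linorder} \<Rightarrow> complex"
  where "numer s = (\<Sum>\<^sub>\<infinity>k. \<Prod>i\<in>UNIV.
    coef (k i) (s $ i) * num i (tail_sum k i) (tail_sum (($) s) i))"

definition denom :: "complex^'d::{finite,linorder} \<Rightarrow> complex"
  where "denom s = (\<Prod>i\<in>UNIV. den (tail_sum (($) s) i))"

text \<open>The solutions of \<open>w ^ K * lat z ^ q = 1\<close>. For negative
  \<open>\<rho>\<close> the principal logarithm contributes \<open>pi * \<i>\<close>, which accounts
  for the term \<ell> of the pole list.\<close>

definition pole_val :: "nat \<Rightarrow> int \<Rightarrow> complex"
  where "pole_val K n = (of_nat K * Ln (of_real \<rho>) + 2 * of_int n * of_real pi * \<i> / of_nat q) / of_real L"

section \<open>Zeros of the factors and growth of the terms\<close>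

lemma norm_w: "norm w < 1" and w_nz: "w \<noteq> 0"
  using \<rho> q by (simp_all add: w_def norm_power power_less_one_iff)

lemma lat_holomorphic: "lat holomorphic_on UNIV"
  unfolding lat_def by (intro holomorphic_intros)

lemma lat_nz: "lat z \<noteq> 0" by (simp add: lat_def)

lemma norm_lat: "norm (lat z) = exp (- (Re z * L))"
  by (simp add: lat_def)

lemma coef_holomorphic: "coef k holomorphic_on UNIV"
  unfolding coef_def gbinomial_prod_rev by (intro holomorphic_intros) auto

lemma qprod_lat_holomorphic: "(\<lambda>z. qprod w A (lat z ^ q)) holomorphic_on UNIV"
proof -
  have "(qprod w A \<circ> (\<lambda>z. lat z ^ q)) holomorphic_on UNIV"
    using lat_holomorphic
    by (intro holomorphic_on_compose_gen[OF _ qprod_holomorphic[OF norm_w]] holomorphic_intros) auto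
  then show ?thesis by (simp add: o_def)
qed

lemma num_holomorphic: "num i K holomorphic_on UNIV"
  unfolding num_def by (intro holomorphic_intros lat_holomorphic qprod_lat_holomorphic)

lemma den_holomorphic: "den holomorphic_on UNIV"
  unfolding den_def by (rule qprod_lat_holomorphic)

lemma w_lat_eq: "w ^ K * lat z ^ q = exp (of_nat q * (of_nat K * Ln (of_real \<rho>) - z * of_real L))"
proof -
  have "w ^ K = exp (of_nat (q * K) * Ln (of_real \<rho>))"
    unfolding exp_of_nat_mult using \<rho> by (simp add: w_def power_mult)
  then show ?thesis
    by (simp add: lat_def exp_of_nat_mult[symmetric] exp_add[symmetric] algebra_simps)
qed

lemma w_lat_eq_1_iff: "w ^ K * lat z ^ q = 1 \<longleftrightarrow> (\<exists>n. z = pole_val K n)"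
proof -
  \<comment> \<open>The exponent contains \<open>- z\<close>, hence the sign change of
    \<open>n\<close>.\<close>
  have "(of_nat q * (of_nat K * Ln (of_real \<rho>) - z * of_real L) = of_int (2 * n) * pi * \<i>) \<longleftrightarrow>
      z = pole_val K (- n)" for n
    using L q by (simp add: pole_val_def field_simps) (auto simp: algebra_simps)
  then have "w ^ K * lat z ^ q = 1 \<longleftrightarrow> (\<exists>n. z = pole_val K (- n))"
    unfolding w_lat_eq using exp_eq[of _ 0] by simp
  also have "\<dots> \<longleftrightarrow> (\<exists>n. z = pole_val K n)" by (metis minus_minus)
  finally show ?thesis .
qed

lemma den_factor: "den z = (1 - w ^ K * lat z ^ q) * qprod w {K} (lat z ^ q)"
  unfolding den_def by (rule qprod_insert[OF norm_w]) simp

lemma den_eq_0_iff: "den z = 0 \<longleftrightarrow> (\<exists>K n. z = pole_val K n)"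
  unfolding den_def qprod_eq_0_iff[OF norm_w] w_lat_eq_1_iff by simp

lemma Re_pole_val: "Re (pole_val K n) = real K * (ln \<bar>\<rho>\<bar> / L)"
  using \<rho> by (simp add: pole_val_def)

text \<open>The real part is \<open>K\<close> times the nonzero number
  \<open>ln \<bar>\<rho>\<bar> / L\<close>.\<close>

lemma pole_val_eq_imp: "pole_val K n = pole_val K' n' \<Longrightarrow> K = K'"
  using Re_pole_val[of K n] Re_pole_val[of K' n'] \<rho> L by auto

text \<open>At this point only the factor of index \<open>K'\<close> of the full product vanishes,
  and \<open>num i K\<close> omits just the factor of index \<open>K\<close>. This selects a single
  term of the numerator at pole values.\<close>

lemma num_pole_val_eq_0_iff: "num i K (pole_val K' n) = 0 \<longleftrightarrow> K \<noteq> K'"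
proof -
  have "num i K (pole_val K' n) = 0 \<longleftrightarrow> (\<exists>m. m \<noteq> K \<and> (\<exists>n'. pole_val K' n = pole_val m n'))"
    using \<rho> r[of i] by (simp add: num_def lat_nz qprod_eq_0_iff[OF norm_w] w_lat_eq_1_iff)
  also have "\<dots> \<longleftrightarrow> K \<noteq> K'" by (metis pole_val_eq_imp)
  finally show ?thesis .
qed

lemma coef_eq_0_iff: "coef k z = 0 \<longleftrightarrow> (\<exists>m<k. z = - of_nat m)"
  by (auto simp: coef_def gbinomial_eq_0_iff minus_equation_iff[of z])

text \<open>Since \<open>r i \<ge> 1\<close> and \<open>K \<ge> k\<close>, the power of
  \<open>\<rho>\<close> in \<open>num\<close> is at most \<open>\<bar>\<rho>\<bar> ^ k\<close>,
  which outweighs the binomial coefficients; the remaining infinite product is bounded independently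
  of \<open>K\<close>.\<close>

lemma coef_num_bound:
  "\<exists>M. summable M \<and> (\<forall>k K z v. k \<le> K \<longrightarrow> norm z \<le> R \<longrightarrow> norm v \<le> R \<longrightarrow>
     norm (coef k z * num i K v) \<le> M k)"
proof (intro exI conjI allI impI)
  let ?E = "exp (R * L)"
  let ?B = "exp (R * \<bar>ln c\<bar>)"
  let ?C = "?E ^ r i * exp (?E ^ q / (1 - norm w))"
  show "summable (\<lambda>k. ?B * ?C * (norm ((- complex_of_real R) gchoose k) * \<bar>\<rho>\<bar> ^ k))"
    using \<rho> by (intro summable_mult summable_norm_gbinomial) auto
  fix k K :: nat and z v assume kK: "k \<le> K" and z: "norm (z::complex) \<le> R" and v: "norm (v::complex) \<le> R"
  have "Re z * ln c \<le> \<bar>Re z\<bar> * \<bar>ln c\<bar>" by (metis abs_ge_self abs_mult)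
  also have "\<dots> \<le> R * \<bar>ln c\<bar>" using z abs_Re_le_cmod[of z] by (intro mult_right_mono) auto
  finally have "norm (coef k z) \<le> ?B * norm ((- complex_of_real R) gchoose k)"
    unfolding coef_def norm_mult norm_power using norm_gbinomial_le[OF z, of k]
    by (simp add: mult_mono)
  moreover have "norm (num i K v) \<le> \<bar>\<rho>\<bar> ^ k * ?C"
  proof -
    have "- (Re v * L) \<le> R * L" using v abs_Re_le_cmod[of v] L
      by (metis abs_ge_minus_self minus_mult_left mult_right_mono order.strict_implies_order order_trans)
    then have E: "norm (lat v) \<le> ?E" by (simp add: norm_lat)
    have "k * 1 \<le> K * r i" using r[of i] kK by (intro mult_le_mono) auto
    then have "k \<le> K * r i" by simp
    then have "\<bar>\<rho>\<bar> ^ (K * r i) \<le> \<bar>\<rho>\<bar> ^ k" using \<rho> by (intro power_decreasing) auto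
    then have 1: "norm ((of_real \<rho> ^ K * lat v) ^ r i) \<le> \<bar>\<rho>\<bar> ^ k * ?E ^ r i"
      unfolding norm_power norm_mult power_mult_distrib power_mult[symmetric]
      using E by (intro mult_mono power_mono) auto
    have "norm (qprod w {K} (lat v ^ q)) \<le> exp (norm (lat v ^ q) / (1 - norm w))"
      by (rule norm_qprod_le[OF norm_w])
    also have "\<dots> \<le> exp (?E ^ q / (1 - norm w))"
      unfolding norm_power using E norm_w by (simp add: divide_right_mono power_mono)
    finally show ?thesis
      unfolding num_def norm_mult using 1 by (simp only: mult.assoc[symmetric]) (intro mult_mono, auto)
  qed
  ultimately have "norm (coef k z * num i K v) \<le>
      (?B * norm ((- complex_of_real R) gchoose k)) * (\<bar>\<rho>\<bar> ^ k * ?C)"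
    unfolding norm_mult by (intro mult_mono) auto
  then show "norm (coef k z * num i K v) \<le> ?B * ?C * (norm ((- complex_of_real R) gchoose k) * \<bar>\<rho>\<bar> ^ k)"
    by (simp only: mult_ac)
qed

section \<open>Numerator and denominator as entire functions\<close>

lemmas numer_series = multi_series[where a = "\<lambda>_. coef" and \<psi> = num,
    OF coef_holomorphic num_holomorphic coef_num_bound]

lemma numer_holomorphic: "numer cvec_holomorphic_on UNIV"
  using numer_series(1) unfolding numer_def[abs_def] .

lemma cvec_holomorphic_tail_sum:
  assumes "f holomorphic_on UNIV"
  shows "(\<lambda>s. f (tail_sum (($) s) i)) cvec_holomorphic_on UNIV"
  by (rule cvec_holomorphic_on_compose[OF assms open_UNIV
        cvec_holomorphic_on_sum[OF cvec_holomorphic_on_nth]]) auto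

lemma denom_holomorphic: "denom cvec_holomorphic_on UNIV"
  unfolding denom_def[abs_def]
  by (intro cvec_holomorphic_on_prod cvec_holomorphic_tail_sum den_holomorphic)

lemma den_nz: "Re z > 0 \<Longrightarrow> den z \<noteq> 0"
proof
  assume z: "Re z > 0" and "den z = 0"
  then obtain K n where "z = pole_val K n" using den_eq_0_iff by blast
  moreover have "ln \<bar>\<rho>\<bar> / L \<le> 0" using \<rho> L by (intro divide_nonpos_pos) auto
  ultimately have "Re z \<le> 0" by (simp only: Re_pole_val) (intro mult_nonneg_nonpos, auto)
  then show False using z by simp
qed

lemma denom_nz: "s \<in> multi_lucas_domain \<Longrightarrow> denom s \<noteq> 0"
  by (auto simp: denom_def multi_lucas_domain_def intro!: den_nz)

lemma denom_nz_ex: "\<exists>s. denom s \<noteq> 0"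
proof
  show "denom (\<chi> i. 1) \<noteq> 0"
    by (rule denom_nz) (auto simp: multi_lucas_domain_def card_gt_0_iff)
qed

lemma denom_nz_near:
  assumes "open W" "W \<noteq> {}"
  shows "\<exists>s\<in>W. denom s \<noteq> 0"
  using cvec_holomorphic_identity[OF denom_holomorphic open_UNIV connected_UNIV assms(1) _ assms(2)]
    denom_nz_ex by auto

section \<open>The quotient and its regular points\<close>

definition F :: "complex^'d::{finite,linorder} \<Rightarrow> complex" where "F s = numer s / denom s"

lemma F_meromorphic: "F cvec_meromorphic_on UNIV"
  unfolding cvec_meromorphic_on_def
  using numer_holomorphic denom_holomorphic denom_nz_ex
  by (intro ballI exI[of _ UNIV] exI[of _ numer] exI[of _ denom])
     (auto simp: F_def connected_UNIV)

lemma F_regularI: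
  assumes g: "g cvec_holomorphic_on UNIV" and h: "h cvec_holomorphic_on UNIV" and hz: "h z \<noteq> 0"
    and F: "\<And>s. denom s \<noteq> 0 \<Longrightarrow> F s = g s / h s"
  shows "cvec_regular_at F z"
proof -
  have "open (h -` (- {0}))"
    using cvec_holomorphic_imp_continuous_on[OF h] by (intro open_vimage) auto
  then obtain e where e: "e > 0" "ball z e \<subseteq> h -` (- {0})"
    using hz open_contains_ball by (metis ComplI singletonD vimageI)
  then have "(\<lambda>s. g s / h s) cvec_holomorphic_on ball z e"
    using g h by (intro cvec_holomorphic_on_divide) (auto intro: cvec_holomorphic_on_subset)
  \<comment> \<open>The exceptional set permitted by \<open>cvec_regular_at\<close> is taken to be
    the zero set of \<open>denom\<close>.\<close>
  moreover have "denom cvec_holomorphic_on ball z e"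
    using denom_holomorphic by (rule cvec_holomorphic_on_subset) auto
  ultimately show ?thesis
    unfolding cvec_regular_at_def using e denom_nz_near[of "ball z e"] F
    by (intro exI[of _ "ball z e"] exI[of _ "\<lambda>s. g s / h s"] exI[of _ denom]) auto
qed

lemma tail_sum_Max: "tail_sum f (Max UNIV) = f (Max UNIV)"
  by (simp add: atLeast_Max_UNIV)

text \<open>The zeros of \<open>den\<close> are simple: only the factor of index \<open>K\<close>
  vanishes, and its derivative there is \<open>q * L\<close>.\<close>

lemma den_deriv_nz: "deriv den (pole_val K n) \<noteq> 0"
proof -
  let ?p = "pole_val K n" and ?\<phi> = "\<lambda>z. qprod w {K} (lat z ^ q)"
  have "((\<lambda>z. 1 - w ^ K * lat z ^ q) has_field_derivative
      of_nat q * of_real L * (w ^ K * lat ?p ^ q)) (at ?p)"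
    unfolding w_lat_eq by (auto intro!: derivative_eq_intros)
  moreover have one: "w ^ K * lat ?p ^ q = 1" using w_lat_eq_1_iff by blast
  ultimately have "((\<lambda>z. (1 - w ^ K * lat z ^ q) * ?\<phi> z) has_field_derivative
      of_nat q * of_real L * ?\<phi> ?p) (at ?p)"
    using DERIV_mult[OF _ holomorphic_derivI[OF qprod_lat_holomorphic open_UNIV UNIV_I]] by fastforce
  then have "deriv den ?p = of_nat q * of_real L * ?\<phi> ?p"
    unfolding den_factor[of _ K, abs_def] by (rule DERIV_imp_deriv)
  moreover have "?\<phi> ?p \<noteq> 0"
    using pole_val_eq_imp by (auto simp: qprod_eq_0_iff[OF norm_w] w_lat_eq_1_iff)
  ultimately show ?thesis using q L by simp
qed

text \<open>Every term vanishes where the last coordinate equals the pole value: the term with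
  \<open>k d = K\<close> through its binomial coefficient, the others through \<open>num\<close>.
  Each term is divided by the linear form and the quotients are summed again.\<close>

lemma numer_divisible:
  assumes can: "m < K" "pole_val K n = - of_nat m"
  shows "\<exists>g. g cvec_holomorphic_on UNIV \<and> (\<forall>s. numer s = (s $ Max UNIV - pole_val K n) * g s)"
proof -
  define d :: 'd where "d = Max UNIV"
  let ?p = "pole_val K n"
  have "\<exists>u. u holomorphic_on UNIV \<and> (\<forall>z. coef k z * num d k z = (z - ?p) * u z)" for k
  proof -
    have "coef k ?p * num d k ?p = 0"
    proof (cases "k = K")
      case True
      then have "coef k ?p = 0" using can coef_eq_0_iff by blast
      then show ?thesis by simp
    next
      case False
      then have "num d k ?p = 0" using num_pole_val_eq_0_iff by blast
      then show ?thesis by simp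
    qed
    from holomorphic_divide_root[of "\<lambda>z. coef k z * num d k z" ?p, OF _ this] show ?thesis
      by (metis coef_holomorphic num_holomorphic holomorphic_on_mult)
  qed
  then obtain u where u: "\<And>k. u k holomorphic_on UNIV"
    and cu: "\<And>k z. coef k z * num d k z = (z - ?p) * u k z" by metis
  \<comment> \<open>At the last index the tail sums are \<open>k d\<close> and \<open>s $ d\<close>,
    so the quotient fits entirely into \<open>a\<close>, with \<open>\<psi> = 1\<close>.\<close>
  define a where "a = (\<lambda>i k. if i = d then u k else coef k)"
  define \<psi> where "\<psi> = (\<lambda>i k. if i = d then (\<lambda>_. 1) else num i k)"
  define T where "T = (\<lambda>k s. \<Prod>i\<in>UNIV. a i (k i) (s $ i) * \<psi> i (tail_sum k i) (tail_sum (($) s) i))"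
  have "(\<lambda>s. \<Sum>\<^sub>\<infinity>k. T k s) cvec_holomorphic_on UNIV"
    unfolding T_def
  proof (rule multi_series(1))
    show "a i k holomorphic_on UNIV" for i k by (simp add: a_def u coef_holomorphic)
    show "\<psi> i k holomorphic_on UNIV" for i k by (simp add: \<psi>_def num_holomorphic)
    show "\<exists>M. summable M \<and> (\<forall>k K z v. k \<le> K \<longrightarrow> norm z \<le> R \<longrightarrow> norm v \<le> R \<longrightarrow>
        norm (a i k z * \<psi> i K v) \<le> M k)" for i R
    proof (cases "i = d")
      case False
      then show ?thesis using coef_num_bound[of R i] by (simp add: a_def \<psi>_def)
    next
      case True
      obtain M where M: "summable M" "\<And>k z. norm z \<le> R + 2 * norm ?p + 1 \<Longrightarrow>
          norm (coef k z * num d k z) \<le> M k"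
        using coef_num_bound[of "R + 2 * norm ?p + 1" d] by blast
      have "norm (u k z) \<le> M k" if "norm z \<le> R" for k z
        by (rule norm_divide_root_le[OF u cu M(2) that])
      then show ?thesis using M(1) True by (auto simp: a_def \<psi>_def)
    qed
  qed
  moreover have "numer s = (s $ d - ?p) * (\<Sum>\<^sub>\<infinity>k. T k s)" for s
  proof -
    have "(\<Prod>i\<in>UNIV. coef (k i) (s $ i) * num i (tail_sum k i) (tail_sum (($) s) i)) =
        (s $ d - ?p) * T k s" for k
    proof -
      have "tail_sum k d = k d" "tail_sum (($) s) d = s $ d"
        unfolding d_def by (rule tail_sum_Max)+
      then show ?thesis
        unfolding T_def by (simp add: prod.remove[of UNIV d] cu a_def \<psi>_def)
    qed
    then show ?thesis unfolding numer_def by (simp add: infsum_cmult_right')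
  qed
  ultimately show ?thesis unfolding d_def by blast
qed

text \<open>Only the factor of \<open>denom\<close> at the last index can vanish at
  \<open>z\<close>, and only to first order. The numerator contains the same linear form; cancelling
  it leaves a denominator that is nonzero at \<open>z\<close>.\<close>

lemma F_regular:
  assumes z: "\<And>j K n. tail_sum (($) z) j = pole_val K n \<Longrightarrow>
    j = Max UNIV \<and> (\<exists>m<K. pole_val K n = - of_nat m)"
  shows "cvec_regular_at F z"
proof (cases "denom z = 0")
  case False
  then show ?thesis
    using numer_holomorphic denom_holomorphic by (intro F_regularI[of numer denom]) (auto simp: F_def)
next
  case True
  define d :: 'd where "d = Max UNIV"
  have nz: "den (tail_sum (($) z) i) \<noteq> 0" if "i \<noteq> d" for i
    using z that unfolding den_eq_0_iff d_def by blast
  have sd: "tail_sum (($) s) d = s $ d" for s :: "complex^'d::{finite,linorder}"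
    unfolding d_def by (rule tail_sum_Max)
  from True nz have "den (tail_sum (($) z) d) = 0"
    unfolding denom_def by (metis (no_types, lifting) prod_zero_iff finite_class.finite_UNIV)
  then obtain K n where Kn: "tail_sum (($) z) d = pole_val K n"
    unfolding den_eq_0_iff by blast
  then obtain m where m: "m < K" "pole_val K n = - of_nat m"
    using z d_def by blast
  obtain g where g: "g cvec_holomorphic_on UNIV"
    and numer: "\<And>s. numer s = (s $ d - pole_val K n) * g s"
    using numer_divisible[OF m] unfolding d_def by blast
  have "den (pole_val K n) = 0" using den_eq_0_iff by blast
  from holomorphic_divide_root[OF den_holomorphic this] obtain u where
    u: "u holomorphic_on UNIV" "\<And>z. den z = (z - pole_val K n) * u z"
      "u (pole_val K n) = deriv den (pole_val K n)" by blast
  define h where "h = (\<lambda>s. u (tail_sum (($) s) d) * (\<Prod>i\<in>UNIV - {d}. den (tail_sum (($) s) i)))"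
  have denom: "denom s = (s $ d - pole_val K n) * h s" for s
    by (simp add: denom_def h_def prod.remove[of UNIV d] u(2) sd)
  show ?thesis
  proof (rule F_regularI[OF g])
    show "h cvec_holomorphic_on UNIV"
      unfolding h_def
      by (intro cvec_holomorphic_on_mult cvec_holomorphic_on_prod cvec_holomorphic_tail_sum
          den_holomorphic u)
    show "h z \<noteq> 0"
      using nz den_deriv_nz by (auto simp: h_def Kn u(3))
    show "F s = g s / h s" if "denom s \<noteq> 0" for s
      using that unfolding F_def numer denom by auto
  qed
qed

section \<open>Singular points\<close>

lemma tail_sum_inject:
  fixes k k' :: "'d \<Rightarrow> nat"
  assumes "\<And>i. tail_sum k i = tail_sum k' i"
  shows "k = k'"
proof (rule ccontr)
  assume "k \<noteq> k'"
  define A where "A = {i. k i \<noteq> k' i}"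
  have A: "finite A" "A \<noteq> {}" using \<open>k \<noteq> k'\<close> by (auto simp: A_def)
  \<comment> \<open>Beyond the last disagreement the entries coincide, so the tail sums at
    \<open>i\<close> differ by the entries at \<open>i\<close>.\<close>
  define i where "i = Max A"
  have "i \<in> A" unfolding i_def using A by (rule Max_in)
  have "l \<notin> A" if "l > i" for l using Max_ge[OF A(1), of l] that leD unfolding i_def by blast
  then have "(\<Sum>l\<in>{i<..}. k l) = (\<Sum>l\<in>{i<..}. k' l)"
    by (intro sum.cong) (auto simp: A_def)
  moreover have "{i..} = insert i {i<..}" by auto
  ultimately show False using assms[of i] \<open>i \<in> A\<close> by (simp add: A_def)
qed

lemma numer_at_pole_vals:
  assumes "\<And>i. tail_sum (($) s) i = pole_val (tail_sum k i) (n i)"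
  shows "numer s = (\<Prod>i\<in>UNIV. coef (k i) (s $ i) * num i (tail_sum k i) (tail_sum (($) s) i))"
proof -
  let ?T = "\<lambda>k. \<Prod>i\<in>UNIV. coef (k i) (s $ i) * num i (tail_sum k i) (tail_sum (($) s) i)"
  have "?T k' = 0" if "k' \<noteq> k" for k'
  proof -
    obtain i where "tail_sum k' i \<noteq> tail_sum k i" using tail_sum_inject[of k' k] \<open>k' \<noteq> k\<close> by blast
    then have "num i (tail_sum k' i) (tail_sum (($) s) i) = 0"
      unfolding assms by (subst num_pole_val_eq_0_iff)
    then show ?thesis by (subst prod_zero_iff) auto
  qed
  then have "numer s = infsum ?T {k}"
    unfolding numer_def by (intro infsum_cong_neutral) auto
  then show ?thesis by simp
qed

text \<open>The witness has tail sums \<open>pole_val K n\<close> up to \<open>j\<close> and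
  \<open>pole_val 0 n'\<close> after \<open>j\<close>. The surviving term has its multi-index
  concentrated at \<open>j\<close>, so only the binomial coefficient at \<open>j\<close> could
  vanish.\<close>

lemma numer_nz_on_hyperplane:
  assumes "\<not> (j = Max UNIV \<and> (\<exists>m<K. pole_val K n = - of_nat m))"
  shows "\<exists>s. tail_sum (($) s) j = pole_val K n \<and> numer s \<noteq> 0"
proof -
  define d :: 'd where "d = Max UNIV"
  have d: "i \<le> d" for i unfolding d_def by (rule Max_ge) auto
  \<comment> \<open>For \<open>j \<noteq> d\<close> this makes the \<open>j\<close>-th coordinate
    non-real, so it is no negative integer and its binomial coefficient is nonzero. One of
    \<open>n' = 0\<close> and \<open>n' = 1\<close> works.\<close>
  obtain n' where n': "j \<noteq> d \<Longrightarrow> Im (pole_val K n) \<noteq> Im (pole_val 0 n')"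
  proof -
    have "Im (pole_val 0 0) \<noteq> Im (pole_val 0 1)" using L q by (simp add: pole_val_def)
    then show ?thesis using that by metis
  qed
  let ?\<theta> = "pole_val 0 n'"
  define s :: "complex^'d::{finite,linorder}" where
    "s = (\<chi> i. (if i = d then ?\<theta> else 0) + (if i = j then pole_val K n - ?\<theta> else 0))"
  define k where "k = (\<lambda>i. if i = j then K else 0)"
  have S: "tail_sum (($) s) i = (if i \<le> j then pole_val K n else ?\<theta>)" for i
    using d[of i] by (simp add: s_def sum.distrib)
  have k: "tail_sum k i = (if i \<le> j then K else 0)" for i
    by (simp add: k_def)
  have "coef (k i) (s $ i) \<noteq> 0" for i
  proof (cases "i = j")
    case False
    then show ?thesis by (simp add: coef_eq_0_iff k_def)
  next
    case True
    show ?thesis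
    proof (cases "j = d")
      case True
      then show ?thesis using assms \<open>i = j\<close> by (simp add: coef_eq_0_iff k_def s_def d_def)
    next
      case False
      then have "Im (s $ i) \<noteq> 0" using n' True by (simp add: s_def)
      then show ?thesis by (auto simp: coef_eq_0_iff)
    qed
  qed
  moreover have "num i (tail_sum k i) (tail_sum (($) s) i) \<noteq> 0" for i
    by (simp add: S k num_pole_val_eq_0_iff)
  moreover have "numer s = (\<Prod>i\<in>UNIV. coef (k i) (s $ i) * num i (tail_sum k i) (tail_sum (($) s) i))"
    by (rule numer_at_pole_vals[where n = "\<lambda>i. if i \<le> j then n else n'"]) (simp add: S k)
  ultimately have "numer s \<noteq> 0" by simp
  moreover have "tail_sum (($) s) j = pole_val K n" by (simp add: S)
  ultimately show ?thesis by blast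
qed

lemma F_singular:
  assumes z: "tail_sum (($) z) j = pole_val K n"
    and unc: "\<not> (j = Max UNIV \<and> (\<exists>m<K. pole_val K n = - of_nat m))"
  shows "\<not> cvec_regular_at F z"
proof
  assume "cvec_regular_at F z"
  then obtain W g h where W: "open W" "connected W" "z \<in> W"
    and g: "g cvec_holomorphic_on W" and h: "h cvec_holomorphic_on W" "\<exists>w\<in>W. h w \<noteq> 0"
    and F: "\<And>s. s \<in> W \<Longrightarrow> h s \<noteq> 0 \<Longrightarrow> F s = g s"
    unfolding cvec_regular_at_def by blast
  have hol: "numer cvec_holomorphic_on W" "denom cvec_holomorphic_on W"
    using numer_holomorphic denom_holomorphic by (auto intro: cvec_holomorphic_on_subset)
  let ?f = "\<lambda>s. numer s - g s * denom s"
  have f: "?f cvec_holomorphic_on W"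
    by (intro cvec_holomorphic_on_diff cvec_holomorphic_on_mult hol g)
  \<comment> \<open>Where \<open>denom\<close> vanishes, \<open>F\<close> gives no information on
    \<open>numer\<close>, hence the extra factor. The factors \<open>h\<close> and
    \<open>denom\<close> are then cancelled one after the other.\<close>
  have "?f s * denom s = 0" if "s \<in> W" for s
  proof (rule cvec_holomorphic_zero_if_mult_zero[OF _ h(1) W(1,2) _ h(2) that])
    show "(\<lambda>s. ?f s * denom s) cvec_holomorphic_on W"
      by (intro cvec_holomorphic_on_mult f hol)
    show "?f s * denom s * h s = 0" if "s \<in> W" for s
      using F[OF that] by (cases "h s = 0"; cases "denom s = 0") (auto simp: F_def field_simps)
  qed
  then have f0: "?f s = 0" if "s \<in> W" for s
    using cvec_holomorphic_zero_if_mult_zero[OF f hol(2) W(1,2)] denom_nz_near[OF W(1)] W(3) that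
    by blast
  obtain s where s: "tail_sum (($) s) j = pole_val K n" "numer s \<noteq> 0"
    using numer_nz_on_hyperplane[OF unc] by blast
  define line where "line = (\<lambda>t. z + t *s (s - z))"
  \<comment> \<open>The tail sum is affine along the line and has equal values at both points, so
    the whole line stays in the hyperplane.\<close>
  have "tail_sum (($) (line t)) j = tail_sum (($) z) j + t * (tail_sum (($) s) j - tail_sum (($) z) j)" for t
    by (simp add: line_def sum.distrib sum_subtractf sum_distrib_left[symmetric] right_diff_distrib)
  then have "tail_sum (($) (line t)) j = pole_val K n" for t using z s by simp
  then have "den (tail_sum (($) (line t)) j) = 0" for t using den_eq_0_iff by blast
  then have denom0: "denom (line t) = 0" for t
    unfolding denom_def by (subst prod_zero_iff) auto
  define T where "T = line -` W"
  have "continuous_on UNIV line"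
    unfolding line_def
    by (intro continuous_intros linear_continuous_on bounded_linear_vector_scalar_mult)
  then have "open T" unfolding T_def by (intro open_vimage W)
  moreover have "0 \<in> T" using W by (simp add: T_def line_def)
  then have "T \<noteq> {}" by blast
  moreover have "(\<lambda>t. numer (line t)) holomorphic_on UNIV"
    unfolding line_def by (rule holomorphic_along_line[OF numer_holomorphic]) auto
  moreover have "numer (line t) = 0" if "t \<in> T" for t
    using f0[of "line t"] that denom0[of t] by (simp add: T_def)
  ultimately have "numer (line 1) = 0"
    using analytic_continuation_open[of T UNIV "\<lambda>t. numer (line t)" "\<lambda>_. 0" 1] by auto
  then show False using s by (simp add: line_def)
qed

lemma F_poles: "cvec_poles F = {s. \<exists>j K n. tail_sum (($) s) j = pole_val K n \<and>
    \<not> (j = Max UNIV \<and> (\<exists>m<K. pole_val K n = - of_nat m))}"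
  unfolding cvec_poles_def using F_regular F_singular by blast

subsection \<open>The series on the domain of convergence\<close>

text \<open>The Lucas number with \<open>\<alpha> ^ N\<close> factored out, ready for the binomial
  series in \<open>\<rho> ^ N\<close>.\<close>

definition U :: "nat \<Rightarrow> real" where "U N = exp (L * N) * (1 - \<rho> ^ N) / c"

definition idx :: "('d \<Rightarrow> nat) \<Rightarrow> 'd \<Rightarrow> nat"
  where "idx n i = q * (\<Sum>l\<in>{..i}. n l) + (\<Sum>l\<in>{..i}. r l)"

lemma idx_pos: "idx n i > 0"
proof -
  have "r i \<le> (\<Sum>l\<in>{..i}. r l)" by (rule member_le_sum) auto
  then show ?thesis using r[of i] by (simp add: idx_def)
qed

text \<open>Positivity of \<open>N\<close> gives \<open>\<bar>\<rho> ^ N\<bar> < 1\<close>, so the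
  binomial series converges and \<open>1 - \<rho> ^ N\<close> is positive; the principal power is
  then the one with the real logarithm.\<close>

lemma U_powr_sums:
  assumes N: "N > 0"
  shows "(\<lambda>k. coef k z * (of_real \<rho> ^ k * lat z) ^ N) sums (1 / complex_of_real (U N) powr z)"
    and "summable (\<lambda>k. norm (coef k z * (of_real \<rho> ^ k * lat z) ^ N))"
proof -
  have \<rho>N: "\<bar>\<rho>\<bar> ^ N < 1" using \<rho> N by (simp add: power_less_one_iff)
  then have pos: "1 - \<rho> ^ N > 0" by (metis abs_ge_self diff_gt_0_iff_gt order_le_less_trans power_abs)
  have eq: "coef k z * (of_real \<rho> ^ k * lat z) ^ N =
      exp (z * of_real (ln c)) * lat z ^ N * (((- z) gchoose k) * (- (of_real \<rho> ^ N)) ^ k)" for k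
    by (simp add: coef_def power_mult_distrib power_mult[symmetric] mult.commute[of k N]
        power_minus[of "of_real \<rho> ^ N"])
  have U: "U N > 0" using pos c by (simp add: U_def)
  have lnU: "ln (U N) = L * N + ln (1 - \<rho> ^ N) - ln c"
    using pos c by (simp add: U_def ln_div ln_mult)
  have "1 / complex_of_real (U N) powr z = exp (- (z * of_real (ln (U N))))"
    using U by (simp add: powr_def Ln_of_real exp_minus field_simps)
  also have "\<dots> = exp (z * of_real (ln c)) * lat z ^ N * exp (- z * of_real (ln (1 - \<rho> ^ N)))"
    by (simp add: lnU lat_def exp_of_nat_mult[symmetric] exp_add[symmetric] algebra_simps)
  also have "exp (- z * of_real (ln (1 - \<rho> ^ N))) = (1 + - (of_real \<rho> ^ N)) powr (- z)"
  proof -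
    have "1 + - (complex_of_real \<rho> ^ N) = of_real (1 - \<rho> ^ N)" by simp
    then show ?thesis using pos by (simp only:) (simp add: powr_def Ln_of_real del: of_real_diff)
  qed
  finally have *: "1 / complex_of_real (U N) powr z =
      exp (z * of_real (ln c)) * lat z ^ N * (1 + - (of_real \<rho> ^ N)) powr (- z)" .
  show "(\<lambda>k. coef k z * (of_real \<rho> ^ k * lat z) ^ N) sums (1 / complex_of_real (U N) powr z)"
    unfolding eq * by (intro sums_mult gen_binomial_complex) (use \<rho>N in \<open>simp add: norm_power\<close>)
  have "summable (\<lambda>k. norm (exp (z * of_real (ln c)) * lat z ^ N) *
      (norm ((- z) gchoose k) * (\<bar>\<rho>\<bar> ^ N) ^ k))"
    using \<rho>N by (intro summable_mult summable_norm_gbinomial) auto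
  then show "summable (\<lambda>k. norm (coef k z * (of_real \<rho> ^ k * lat z) ^ N))"
    unfolding eq by (simp add: norm_mult norm_power)
qed

lemma summable_coef: "summable (\<lambda>k. norm (coef k z) * \<bar>\<rho>\<bar> ^ k)"
proof -
  have "summable (\<lambda>k. norm (exp (z * of_real (ln c))) * (norm ((- z) gchoose k) * \<bar>\<rho>\<bar> ^ k))"
    using \<rho> by (intro summable_mult summable_norm_gbinomial) auto
  then show ?thesis by (simp add: coef_def norm_mult norm_power mult.assoc)
qed

text \<open>The type is general because the series is needed for complex numbers and for their
  norms.\<close>

lemma geometric_shifted_sums:
  fixes x :: "'a::{real_normed_field,banach}"
  assumes "norm x < 1"
  shows "(\<lambda>n. x ^ (q * n + R)) sums (x ^ R / (1 - x ^ q))"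
    and "summable (\<lambda>n. norm (x ^ (q * n + R)))"
proof -
  have xq: "norm (x ^ q) < 1" using assms q by (simp add: norm_power power_less_one_iff)
  show "(\<lambda>n. x ^ (q * n + R)) sums (x ^ R / (1 - x ^ q))"
    using sums_mult[OF geometric_sums[OF xq], of "x ^ R"]
    by (simp add: power_add power_mult[of x q] mult.commute[of "x ^ R"])
  show "summable (\<lambda>n. norm (x ^ (q * n + R)))"
    using summable_mult[OF summable_geometric, of "norm (x ^ q)" "norm (x ^ R)"] xq
    by (simp add: power_add power_mult[of x q] norm_mult norm_power mult.commute[of _ "norm x ^ R"])
qed

text \<open>The double series \<open>t k n\<close> is summed in two ways: over \<open>k\<close>
  first it gives the products of powers of \<open>U\<close>, over \<open>n\<close> first the terms
  of \<open>numer\<close> divided by \<open>denom\<close>. Absolute summability justifies the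
  exchange.\<close>

lemma F_eq_series:
  assumes s: "s \<in> multi_lucas_domain"
  shows "F s = (\<Sum>\<^sub>\<infinity>n. \<Prod>i\<in>UNIV. 1 / complex_of_real (U (idx n i)) powr (s $ i))"
proof -
  define S where "S = (\<lambda>i. tail_sum (($) s) i)"
  define X where "X = (\<lambda>k i. of_real \<rho> ^ tail_sum k i * lat (S i))"
  define y where "y = (\<lambda>i. exp (- (Re (S i) * L)))"
  define t where "t = (\<lambda>k n. \<Prod>i\<in>UNIV. coef (k i) (s $ i) * (of_real \<rho> ^ k i * lat (s $ i)) ^ idx n i)"
  have y: "0 < y i" "y i < 1" for i
    using s L by (auto simp: y_def S_def multi_lucas_domain_def)
  have norm_X: "norm (X k i) = \<bar>\<rho>\<bar> ^ tail_sum k i * y i" for k i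
    by (simp add: X_def y_def norm_mult norm_power norm_lat)
  have X_le: "norm (X k i) \<le> \<bar>\<rho>\<bar> ^ k i" "norm (X k i) \<le> y i" for k i
  proof -
    have "k i \<le> tail_sum k i" by (rule member_le_sum) auto
    then have "\<bar>\<rho>\<bar> ^ tail_sum k i \<le> \<bar>\<rho>\<bar> ^ k i" using \<rho> by (intro power_decreasing) auto
    then have "\<bar>\<rho>\<bar> ^ tail_sum k i * y i \<le> \<bar>\<rho>\<bar> ^ k i * 1" using y[of i] by (intro mult_mono) auto
    then show "norm (X k i) \<le> \<bar>\<rho>\<bar> ^ k i" by (simp add: norm_X)
    have "\<bar>\<rho>\<bar> ^ tail_sum k i * y i \<le> 1 * y i"
      using \<rho> y[of i] by (intro mult_right_mono power_le_one) auto
    then show "norm (X k i) \<le> y i" by (simp add: norm_X)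
  qed
  have X_less: "norm (X k i) < 1" for k i using X_le(2)[of k i] y(2)[of i] by linarith
  \<comment> \<open>Each \<open>idx n i\<close> is a head sum of the numbers
    \<open>q * n l + r l\<close>; regrouping by \<open>l\<close> decouples the summation over
    \<open>n\<close>.\<close>
  have t_eq: "t k n = (\<Prod>i\<in>UNIV. coef (k i) (s $ i)) * (\<Prod>i\<in>UNIV. X k i ^ (q * n i + r i))" for k n
  proof -
    have "idx n i = (\<Sum>l\<in>{..i}. q * n l + r l)" for i
      by (simp add: idx_def sum.distrib sum_distrib_left)
    then have "(\<Prod>i\<in>UNIV. (of_real \<rho> ^ k i * lat (s $ i)) ^ idx n i) =
        (\<Prod>l\<in>UNIV. (\<Prod>i\<in>{l..}. of_real \<rho> ^ k i * lat (s $ i)) ^ (q * n l + r l))"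
      by (simp only: prod_power_head_sum)
    moreover have "(\<Prod>i\<in>{l..}. of_real \<rho> ^ k i * lat (s $ i)) = X k l" for l
      by (simp add: X_def S_def lat_def prod.distrib power_sum exp_sum[symmetric]
          sum_negf sum_distrib_right)
    ultimately show ?thesis by (simp only: t_def prod.distrib)
  qed
  define g where "g = (\<lambda>k. (\<Prod>i\<in>UNIV. norm (coef (k i) (s $ i))) *
      (\<Prod>i\<in>UNIV. norm (X k i) ^ r i / (1 - norm (X k i) ^ q)))"
  have t_n: "((\<lambda>n. norm (t k n)) has_sum g k) UNIV" for k
  proof -
    have sm: "summable (\<lambda>n. norm (norm (X k i) ^ (q * n + r i)))" for i
      by (rule geometric_shifted_sums(2)) (use X_less in simp)
    have 1: "(\<lambda>n. \<Prod>i\<in>UNIV. norm (X k i) ^ (q * n i + r i)) summable_on UNIV"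
      using abs_summable_prod_UNIV[OF sm] by (simp add: abs_prod)
    have 2: "(\<Sum>\<^sub>\<infinity>n. \<Prod>i\<in>UNIV. norm (X k i) ^ (q * n i + r i)) =
        (\<Prod>i\<in>UNIV. norm (X k i) ^ r i / (1 - norm (X k i) ^ q))"
    proof -
      have "(\<Sum>n. norm (X k i) ^ (q * n + r i)) = norm (X k i) ^ r i / (1 - norm (X k i) ^ q)" for i
        by (rule sums_unique[symmetric], rule geometric_shifted_sums(1)) (use X_less in simp)
      then show ?thesis unfolding infsum_prod_UNIV[OF sm] by simp
    qed
    have "((\<lambda>n. \<Prod>i\<in>UNIV. norm (X k i) ^ (q * n i + r i)) has_sum
        (\<Prod>i\<in>UNIV. norm (X k i) ^ r i / (1 - norm (X k i) ^ q))) UNIV"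
      using has_sum_infsum[OF 1] unfolding 2 .
    from has_sum_cmult_right[OF this, of "\<Prod>i\<in>UNIV. norm (coef (k i) (s $ i))"] show ?thesis
      by (simp add: t_eq g_def norm_mult prod_norm[symmetric] norm_power)
  qed
  have g_summable: "g summable_on UNIV"
  proof -
    have sm: "summable (\<lambda>k. norm (norm (coef k (s $ i)) * \<bar>\<rho>\<bar> ^ k * (1 / (1 - y i))))" for i
      using summable_mult2[OF summable_coef[of "s $ i"], of "1 / (1 - y i)"] y[of i] by (simp add: abs_mult)
    have "norm (g k) \<le> norm (\<Prod>i\<in>UNIV. norm (coef (k i) (s $ i)) * \<bar>\<rho>\<bar> ^ k i * (1 / (1 - y i)))" for k
    proof -
      have "norm (X k i) ^ r i / (1 - norm (X k i) ^ q) \<le> \<bar>\<rho>\<bar> ^ k i * (1 / (1 - y i))" for i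
      proof -
        \<comment> \<open>As the norm is below 1, both exponents may be lowered to 1. The numerator
          then decays in \<open>k i\<close>, and the denominator is at least \<open>1 - y i\<close>,
          uniformly in \<open>k\<close>.\<close>
        have "norm (X k i) ^ r i \<le> norm (X k i) ^ 1" "norm (X k i) ^ q \<le> norm (X k i) ^ 1"
          using X_less[of k i] r[of i] q by (intro power_decreasing; simp)+
        then have "norm (X k i) ^ r i \<le> \<bar>\<rho>\<bar> ^ k i" "norm (X k i) ^ q \<le> y i"
          using X_le[of k i] by simp_all
        then have "norm (X k i) ^ r i / (1 - norm (X k i) ^ q) \<le> \<bar>\<rho>\<bar> ^ k i / (1 - y i)"
          using y[of i] by (intro frac_le) auto
        then show ?thesis by simp
      qed
      moreover have "0 \<le> norm (X k i) ^ r i / (1 - norm (X k i) ^ q)" for i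
        using X_less[of k i] by (simp add: power_le_one)
      ultimately have "0 \<le> norm (coef (k i) (s $ i)) * (norm (X k i) ^ r i / (1 - norm (X k i) ^ q)) \<and>
          norm (coef (k i) (s $ i)) * (norm (X k i) ^ r i / (1 - norm (X k i) ^ q)) \<le>
          norm (coef (k i) (s $ i)) * \<bar>\<rho>\<bar> ^ k i * (1 / (1 - y i))" for i
        unfolding mult.assoc by (intro conjI mult_nonneg_nonneg mult_left_mono) auto
      then have "0 \<le> g k \<and> g k \<le> (\<Prod>i\<in>UNIV. norm (coef (k i) (s $ i)) * \<bar>\<rho>\<bar> ^ k i * (1 / (1 - y i)))"
        unfolding g_def prod.distrib[symmetric] by (intro conjI prod_nonneg prod_mono) auto
      then show ?thesis by auto
    qed
    then have "(\<lambda>k. norm (g k)) summable_on UNIV"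
      by (intro Infinite_Sum.abs_summable_on_comparison_test[OF abs_summable_prod_UNIV[OF sm]])
    then show ?thesis by (rule abs_summable_summable)
  qed
  have "(\<lambda>p. norm (case p of (k, n) \<Rightarrow> t k n)) summable_on UNIV \<times> UNIV"
    by (rule summable_on_SigmaI[where g = g]) (use t_n g_summable in auto)
  then have swap: "(\<Sum>\<^sub>\<infinity>k. \<Sum>\<^sub>\<infinity>n. t k n) = (\<Sum>\<^sub>\<infinity>n. \<Sum>\<^sub>\<infinity>k. t k n)"
    by (intro infsum_swap_banach) (rule abs_summable_summable)
  have sum_n: "(\<Sum>\<^sub>\<infinity>n. t k n) =
      (\<Prod>i\<in>UNIV. coef (k i) (s $ i) * num i (tail_sum k i) (S i)) * (1 / denom s)" for k
  proof -
    have "(\<Sum>\<^sub>\<infinity>n. t k n) = (\<Prod>i\<in>UNIV. coef (k i) (s $ i)) * (\<Sum>\<^sub>\<infinity>n. \<Prod>i\<in>UNIV. X k i ^ (q * n i + r i))"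
      unfolding t_eq by (rule infsum_cmult_right')
    also have "(\<Sum>\<^sub>\<infinity>n. \<Prod>i\<in>UNIV. X k i ^ (q * n i + r i)) = (\<Prod>i\<in>UNIV. X k i ^ r i / (1 - X k i ^ q))"
    proof -
      have "(\<Sum>n. X k i ^ (q * n + r i)) = X k i ^ r i / (1 - X k i ^ q)" for i
        by (rule sums_unique[symmetric], rule geometric_shifted_sums(1)) (rule X_less)
      then show ?thesis
        by (subst infsum_prod_UNIV[OF geometric_shifted_sums(2)[OF X_less]]) simp
    qed
    also have "\<dots> = (\<Prod>i\<in>UNIV. num i (tail_sum k i) (S i) / den (S i))"
    proof (rule prod.cong)
      fix i
      have "den (S i) \<noteq> 0" using s by (intro den_nz) (auto simp: S_def multi_lucas_domain_def)
      moreover have "den (S i) = (1 - X k i ^ q) * qprod w {tail_sum k i} (lat (S i) ^ q)"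
        unfolding den_factor[of _ "tail_sum k i"]
        by (simp add: X_def w_def power_mult_distrib power_mult[symmetric] mult.commute)
      ultimately show "X k i ^ r i / (1 - X k i ^ q) = num i (tail_sum k i) (S i) / den (S i)"
        by (simp add: num_def X_def)
    qed simp
    finally show ?thesis
      by (simp add: prod.distrib prod_dividef denom_def S_def)
  qed
  have sum_k: "(\<Sum>\<^sub>\<infinity>k. t k n) = (\<Prod>i\<in>UNIV. 1 / complex_of_real (U (idx n i)) powr (s $ i))" for n
    unfolding t_def infsum_prod_UNIV[OF U_powr_sums(2)[OF idx_pos]]
    by (simp only: sums_unique[OF U_powr_sums(1)[OF idx_pos]])
  have "F s = (\<Sum>\<^sub>\<infinity>k. \<Sum>\<^sub>\<infinity>n. t k n)"
    unfolding sum_n F_def numer_def S_def by (subst infsum_cmult_left') simp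
  then show ?thesis unfolding swap sum_k .
qed

end

subsection \<open>Lucas sequences\<close>

lemma lucas_alpha_minus_beta: "lucas_alpha P Q - lucas_beta P Q = sqrt (P\<^sup>2 - 4 * Q)"
  by (simp add: lucas_alpha_def lucas_beta_def field_simps)

text \<open>The two inequalities behind the absolute value are \<alpha> - \<beta> > 0 and \<alpha> +
  \<beta> = P > 0.\<close>

lemma abs_lucas_beta_less:
  assumes "P > 0" "P\<^sup>2 - 4 * Q > 0"
  shows "\<bar>lucas_beta P Q\<bar> < lucas_alpha P Q"
proof -
  have "sqrt (P\<^sup>2 - 4 * Q) > 0" using assms by simp
  then have "lucas_beta P Q < lucas_alpha P Q" unfolding lucas_alpha_minus_beta[symmetric] by simp
  moreover have "lucas_alpha P Q + lucas_beta P Q = P"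
    by (simp add: lucas_alpha_def lucas_beta_def field_simps)
  ultimately show ?thesis using assms by (simp add: abs_less_iff)
qed

theorem theorem5:
  fixes P Q :: real and q :: nat and r :: "'d::{finite,linorder} \<Rightarrow> nat"
  assumes "P > 0" and "Q \<noteq> 0"
    and "P \<le> 2 \<longrightarrow> Q < P - 1" and "P > 2 \<longrightarrow> Q \<le> P - 1"
    and "q \<ge> 2" and "\<forall>j. r j > 0"
  shows "\<exists>F :: complex^'d::{finite,linorder} \<Rightarrow> complex.
    F cvec_meromorphic_on UNIV \<and>
    (\<forall>s\<in>multi_lucas_domain. F s = multi_lucas_zeta P Q q r s) \<and>
    cvec_poles F =
      (\<Union>(j, k, n) \<in> {(j, k, n). \<not> lucas_cancelled P Q q j k n}. lucas_hyperplane P Q q j k n)"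
proof -
  define \<alpha> where "\<alpha> = lucas_alpha P Q"
  define \<beta> where "\<beta> = lucas_beta P Q"
  define \<rho> where "\<rho> = \<beta> / \<alpha>"
  define L where "L = ln \<alpha>"
  note a1 = lucas_alpha_gt_1[OF assms(1,3,4)]
  have \<alpha>: "\<alpha> > 1" using a1 by (simp add: \<alpha>_def)
  have Q: "\<alpha> * \<beta> = Q" unfolding \<alpha>_def \<beta>_def using a1 by (intro lucas_alpha_times_beta)
  then have \<beta>: "\<beta> \<noteq> 0" "\<bar>\<beta>\<bar> < \<alpha>"
    using assms a1 abs_lucas_beta_less by (auto simp: \<alpha>_def \<beta>_def)
  have L: "L > 0" using \<alpha> by (simp add: L_def)
  interpret geometric_zeta L \<rho> "\<alpha> - \<beta>" q r
    by unfold_locales (use L \<alpha> \<beta> assms in \<open>auto simp: \<rho>_def\<close>)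
  have U: "U N = lucas_U P Q N" for N
  proof -
    have "exp (L * N) = \<alpha> ^ N"
      using \<alpha> exp_of_nat_mult[of N L] by (simp add: L_def mult.commute)
    moreover have "\<alpha> ^ N * \<rho> ^ N = \<beta> ^ N"
      using \<alpha> by (simp add: \<rho>_def flip: power_mult_distrib)
    ultimately show ?thesis
      by (simp add: U_def lucas_U_def right_diff_distrib flip: \<alpha>_def \<beta>_def)
  qed
  \<comment> \<open>Because \<open>\<rho> = Q / \<alpha> ^ 2\<close>, the signs of
    \<open>\<rho>\<close> and \<open>Q\<close> agree. This translates \<open>pole_val\<close> into
    the stated pole values.\<close>
  have Ln_\<rho>: "Ln (of_real \<rho>) = of_real (ln \<bar>Q\<bar> - 2 * L) + (if Q > 0 then 0 else of_real pi * \<i>)"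
  proof -
    have "\<bar>Q\<bar> = \<alpha> * \<alpha> * \<bar>\<rho>\<bar>" using \<alpha> by (simp add: \<rho>_def abs_mult flip: Q)
    then have ln_\<rho>: "ln \<bar>\<rho>\<bar> = ln \<bar>Q\<bar> - 2 * L"
      using \<alpha> \<rho> by (simp add: L_def ln_mult)
    have "\<rho> > 0 \<longleftrightarrow> Q > 0" using \<alpha> by (auto simp: \<rho>_def zero_less_divide_iff zero_less_mult_iff simp flip: Q)
    then show ?thesis
      using \<rho>(1) unfolding ln_\<rho>[symmetric]
      by (cases "\<rho> > 0") (simp_all add: Ln_of_real' mult.commute)
  qed
  have pole: "lucas_pole_value P Q q j k n = pole_val (tail_sum k j) n" for j and k :: "'d \<Rightarrow> nat" and n
    using L q unfolding lucas_pole_value_def pole_val_def Ln_\<rho> lucas_ell_def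
    by (simp add: field_simps flip: \<alpha>_def L_def)
  have cancelled: "lucas_cancelled P Q q j k n \<longleftrightarrow>
      j = Max UNIV \<and> (\<exists>m<tail_sum k j. pole_val (tail_sum k j) n = - of_nat m)"
    for j and k :: "'d \<Rightarrow> nat" and n
    unfolding lucas_cancelled_def pole by (auto simp: tail_sum_Max)
  have "F s = multi_lucas_zeta P Q q r s" if "s \<in> multi_lucas_domain" for s
    unfolding F_eq_series[OF that] multi_lucas_zeta_def U idx_def ..
  moreover have "cvec_poles F =
      (\<Union>(j, k, n) \<in> {(j, k, n). \<not> lucas_cancelled P Q q j k n}. lucas_hyperplane P Q q j k n)" (is "_ = ?R")
  proof (intro equalityI subsetI)
    fix s assume "s \<in> cvec_poles F"
    then obtain j K n where s: "tail_sum (($) s) j = pole_val K n"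
      and unc: "\<not> (j = Max UNIV \<and> (\<exists>m<K. pole_val K n = - of_nat m))"
      unfolding F_poles by blast
    \<comment> \<open>Any \<open>K\<close> occurs as a tail sum at \<open>j\<close>, for instance
      with all its weight at \<open>j\<close>.\<close>
    define k where "k = (\<lambda>i. if i = j then K else 0)"
    have "tail_sum k j = K" by (simp add: k_def)
    then have "\<not> lucas_cancelled P Q q j k n" "s \<in> lucas_hyperplane P Q q j k n"
      using s unc by (simp_all add: lucas_hyperplane_def cancelled pole)
    then show "s \<in> ?R"
      by blast
  next
    fix s assume "s \<in> ?R"
    then obtain j k n where "\<not> lucas_cancelled P Q q j k n" "s \<in> lucas_hyperplane P Q q j k n"
      by blast
    then show "s \<in> cvec_poles F"
      unfolding F_poles lucas_hyperplane_def cancelled pole by blast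
  qed
  ultimately show ?thesis using F_meromorphic by blast
qed

end
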